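(* Consider the online unconstrained profit-maximization problem in the random-order model, where the cost function $g:\mathbb{R}^d_{\ge 0}\to\mathbb{R}_{\ge 0}$ is convex, non-decreasing, \emph{supermodular}, and satisfies the regularity conditions: $g$ is strictly convex, closed, differentiable, $g(0)=0$, and the gradients of $g$ tend to $+\infty$ along every positive direction. Then there is a randomized online algorithm that is $O(d)$-competitive, i.e., whose expected profit is at least $\mathrm{opt}/O(d)$.
   Context: Problem: a universe $U$ of $n$ items is fixed by an adversary; each item $e$ has a value $v(e)\in\mathbb{R}_{\ge0}$ and a size vector $s(e)\in\mathbb{R}^d_{\ge0}$. The items arrive one by one in a uniformly random order; when an item arrives its value and size are revealed and the algorithm must irrevocably accept or reject it. If the accepted set is $A$, the profit is $\pi(A)=\sum_{e\in A}v(e)-g\big(\sum_{e\in A}s(e)\big)$. In the unconstrained problem every subset of $U$ may be accepted, and $\mathrm{opt}=\max_{A\subseteq U}\pi(A)$. A function $g$ on $\mathbb{R}^d_{\ge0}$ is supermodular if $g(x)+g(y)\le g(x\wedge y)+g(x\vee y)$ for all $x,y$, where $\wedge,\vee$ are the coordinatewise minimum and maximum (for differentiable convex $g$ this is equivalent to $\nabla g$ being coordinatewise non-decreasing). An algorithm is $c$-competitive if its expected profit (over the random order and its internal randomness) is at least $\mathrm{opt}/c$ for every instance. *)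

theory Defs
  imports "HOL-Probability.Probability" "HOL-Combinatorics.Multiset_Permutations"
begin

text \<open>
  The dimension \<open>d\<close> has to be quantified inside the theorem, because the constant hidden in
  \<open>O(d)\<close> must not depend on it. So \<open>\<real>\<^sup>d\<close> is the carrier of the library topology
  \<open>Euclidean_space d\<close>: functions on \<open>nat\<close> that vanish at all indices \<open>i \<ge> d\<close>. On these,
  the pointwise order and lattice operations of functions are the coordinatewise ones.
\<close>

definition orthant :: "nat \<Rightarrow> (nat \<Rightarrow> real) set" where
  "orthant d = {x \<in> topspace (Euclidean_space d). \<forall>i. 0 \<le> x i}"

definition dot :: "nat \<Rightarrow> (nat \<Rightarrow> real) \<Rightarrow> (nat \<Rightarrow> real) \<Rightarrow> real" where
  "dot d x y = (\<Sum>i<d. x i * y i)"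


subsection \<open>Cost functions\<close>

text \<open>
  Only the values of a cost function on the orthant matter. At boundary points the gradient is
  relative to the orthant; it is still unique, as the orthant has nonempty interior in \<open>\<real>\<^sup>d\<close>.
\<close>

definition has_gradient :: "nat \<Rightarrow> ((nat \<Rightarrow> real) \<Rightarrow> real) \<Rightarrow> (nat \<Rightarrow> real) \<Rightarrow> (nat \<Rightarrow> real) \<Rightarrow> bool" where
  "has_gradient d g p x \<longleftrightarrow>
     p \<in> topspace (Euclidean_space d) \<and>
     (\<forall>\<epsilon>>0. \<exists>\<delta>>0. \<forall>y\<in>orthant d. L2_set (\<lambda>i. y i - x i) {..<d} < \<delta> \<longrightarrow>
        \<bar>g y - g x - dot d p (\<lambda>i. y i - x i)\<bar> \<le> \<epsilon> * L2_set (\<lambda>i. y i - x i) {..<d})"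

definition gradient :: "nat \<Rightarrow> ((nat \<Rightarrow> real) \<Rightarrow> real) \<Rightarrow> (nat \<Rightarrow> real) \<Rightarrow> (nat \<Rightarrow> real)" where
  "gradient d g x = (THE p. has_gradient d g p x)"

definition differentiable_cost :: "nat \<Rightarrow> ((nat \<Rightarrow> real) \<Rightarrow> real) \<Rightarrow> bool" where
  "differentiable_cost d g \<longleftrightarrow> (\<forall>x\<in>orthant d. \<exists>p. has_gradient d g p x)"

definition convex_cost :: "nat \<Rightarrow> ((nat \<Rightarrow> real) \<Rightarrow> real) \<Rightarrow> bool" where
  "convex_cost d g \<longleftrightarrow>
     (\<forall>x\<in>orthant d. \<forall>y\<in>orthant d. \<forall>t. 0 \<le> t \<and> t \<le> 1 \<longrightarrow>
        g (\<lambda>i. (1 - t) * x i + t * y i) \<le> (1 - t) * g x + t * g y)"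

definition strictly_convex_cost :: "nat \<Rightarrow> ((nat \<Rightarrow> real) \<Rightarrow> real) \<Rightarrow> bool" where
  "strictly_convex_cost d g \<longleftrightarrow>
     (\<forall>x\<in>orthant d. \<forall>y\<in>orthant d. \<forall>t. x \<noteq> y \<and> 0 < t \<and> t < 1 \<longrightarrow>
        g (\<lambda>i. (1 - t) * x i + t * y i) < (1 - t) * g x + t * g y)"

definition closed_cost :: "nat \<Rightarrow> ((nat \<Rightarrow> real) \<Rightarrow> real) \<Rightarrow> bool" where
  "closed_cost d g \<longleftrightarrow>
     closedin (prod_topology (Euclidean_space d) euclideanreal) {(x, r). x \<in> orthant d \<and> g x \<le> r}"

definition supermodular :: "nat \<Rightarrow> ((nat \<Rightarrow> real) \<Rightarrow> real) \<Rightarrow> bool" where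
  "supermodular d g \<longleftrightarrow>
     (\<forall>x\<in>orthant d. \<forall>y\<in>orthant d. g x + g y \<le> g (inf x y) + g (sup x y))"

text \<open>
  Divergence is that of the directional derivative along the ray. For a non-decreasing \<open>g\<close> the
  gradients are nonnegative, so for strictly positive \<open>u\<close> this is the same as divergence of the
  norm of the gradient.
\<close>

definition gradients_unbounded :: "nat \<Rightarrow> ((nat \<Rightarrow> real) \<Rightarrow> real) \<Rightarrow> bool" where
  "gradients_unbounded d g \<longleftrightarrow>
     (\<forall>u\<in>topspace (Euclidean_space d). (\<forall>i<d. 0 < u i) \<longrightarrow>
        filterlim (\<lambda>t::real. dot d (gradient d g (\<lambda>i. t * u i)) u) at_top at_top)"

definition regular_cost :: "nat \<Rightarrow> ((nat \<Rightarrow> real) \<Rightarrow> real) \<Rightarrow> bool" where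
  "regular_cost d g \<longleftrightarrow>
     strictly_convex_cost d g \<and> closed_cost d g \<and> differentiable_cost d g \<and>
     g (\<lambda>i. 0) = 0 \<and> gradients_unbounded d g"


subsection \<open>The online problem\<close>

text \<open>The items are \<open>0, \<dots>, n - 1\<close>, with values \<open>v\<close> and size vectors \<open>s\<close>.\<close>

definition valid_instance ::
    "nat \<Rightarrow> nat \<Rightarrow> (nat \<Rightarrow> real) \<Rightarrow> (nat \<Rightarrow> nat \<Rightarrow> real) \<Rightarrow> bool" where
  "valid_instance d n v s \<longleftrightarrow> (\<forall>e<n. 0 \<le> v e \<and> s e \<in> orthant d)"

definition profit ::
    "((nat \<Rightarrow> real) \<Rightarrow> real) \<Rightarrow> (nat \<Rightarrow> real) \<Rightarrow> (nat \<Rightarrow> nat \<Rightarrow> real) \<Rightarrow> nat set \<Rightarrow> real" where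
  "profit g v s A = (\<Sum>e\<in>A. v e) - g (\<lambda>i. \<Sum>e\<in>A. s e i)"

definition opt ::
    "((nat \<Rightarrow> real) \<Rightarrow> real) \<Rightarrow> nat \<Rightarrow> (nat \<Rightarrow> real) \<Rightarrow> (nat \<Rightarrow> nat \<Rightarrow> real) \<Rightarrow> real" where
  "opt g n v s = Max (profit g v s ` Pow {..<n})"

text \<open>
  A deterministic online algorithm decides on the current item from the values and sizes revealed
  so far, in order of arrival and with the current item last. Its own earlier decisions are a
  function of this history. Item names are not revealed.
\<close>

type_synonym online_alg = "(real \<times> (nat \<Rightarrow> real)) list \<Rightarrow> bool"

definition accepted ::
    "online_alg \<Rightarrow> (nat \<Rightarrow> real) \<Rightarrow> (nat \<Rightarrow> nat \<Rightarrow> real) \<Rightarrow> nat list \<Rightarrow> nat set" where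
  "accepted alg v s \<sigma> =
     {\<sigma> ! k | k. k < length \<sigma> \<and> alg (map (\<lambda>e. (v e, s e)) (take (Suc k) \<sigma>))}"

text \<open>
  A randomized online algorithm is a probability distribution over deterministic ones, drawn
  independently of the uniformly random arrival order.
\<close>

definition expected_profit ::
    "((nat \<Rightarrow> real) \<Rightarrow> real) \<Rightarrow> nat \<Rightarrow> online_alg pmf \<Rightarrow>
     (nat \<Rightarrow> real) \<Rightarrow> (nat \<Rightarrow> nat \<Rightarrow> real) \<Rightarrow> real" where
  "expected_profit g n R v s =
     measure_pmf.expectation (pair_pmf R (pmf_of_set (permutations_of_set {..<n})))
       (\<lambda>(alg, \<sigma>). profit g v s (accepted alg v s \<sigma>))"

definition competitive ::
    "nat \<Rightarrow> ((nat \<Rightarrow> real) \<Rightarrow> real) \<Rightarrow> nat \<Rightarrow> online_alg pmf \<Rightarrow> real \<Rightarrow> bool" where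
  "competitive d g n R c \<longleftrightarrow>
     (\<forall>v s. valid_instance d n v s \<longrightarrow> expected_profit g n R v s \<ge> opt g n v s / c)"

end

(*
  Fix a scale t and let p be the price vector whose i-th entry is the largest q such that the
  conjugate of g restricted to the i-th axis is at most t at q. As g is superadditive, the
  surplus h(y) = <p,y> - g(y) is at most d t everywhere, so opt is at most d t plus the total
  residual value v(e) - <p,s(e)> of the items worth their price. Conversely, call a load y
  saturated if h(x) <= h(y) for all x <= y. Convexity shows that a load that is not
  saturated dominates one of surplus at least t. So if items worth their price are taken greedily
  while the load stays saturated, then either all positive residuals are collected or the
  profit reaches about t, provided that no single item is worth a constant fraction of t. Items
  too large to be saturated alone are negligible: an optimal set contains at most 2d of them.
  For t of order opt/d, estimated from the first half of the items, both outcomes give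
  a profit of order opt/d. If a single item is worth a constant fraction of opt/d, a secretary
  rule finds it. The algorithm picks one of the strategies at random.
*)

theory Submission
  imports Defs "HOL-Library.Function_Algebras"
begin

subsection \<open>Supermodular convex costs\<close>

text \<open>The factor \<open>d\<close> is the gap between two bounds at one price vector: duality
  charges the optimum up to \<open>d * \<tau>\<close> of surplus, while a blocked greedy run is only
  sure of about one \<open>\<tau>\<close>. The obstacle is that profit is not monotone: a wrong
  \<open>\<tau>\<close> or one item too many could make it negative and spoil an average over
  strategies. Saturation prevents this. A saturated load has nonnegative surplus whatever
  \<open>\<tau>\<close> is, so greedy never loses in any arrival order, and gains need to be proved
  on favourable orders only. Saturation also passes to smaller loads, so an item once rejected for
  lack of room never fits later; this makes the result of a single pass maximal. The sampled optimum
  must be within a constant factor of the true one. Marginal values bound the profit of subsets of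
  an optimal set below by an additive weight, and Chebyshev's inequality applies once no weight
  exceeds \<open>opt / 128\<close>. The case split at \<open>opt / (128 * d)\<close> supplies this,
  and on balanced orders it also makes \<open>M\<close> at most \<open>\<tau> / 4\<close>.\<close>

lemma orthant_iff: "x \<in> orthant d \<longleftrightarrow> (\<forall>i\<ge>d. x i = 0) \<and> (\<forall>i. 0 \<le> x i)"
  by (auto simp: orthant_def topspace_Euclidean_space)

lemma zero_in_orthant [simp]: "0 \<in> orthant d"
  by (simp add: orthant_iff)

lemma add_in_orthant [simp]: "x \<in> orthant d \<Longrightarrow> y \<in> orthant d \<Longrightarrow> x + y \<in> orthant d"
  by (simp add: orthant_iff)

lemma diff_in_orthant: "x \<in> orthant d \<Longrightarrow> y \<in> orthant d \<Longrightarrow> x \<le> y \<Longrightarrow> y - x \<in> orthant d"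
  by (auto simp: orthant_iff le_fun_def)

lemma sum_in_orthant: "(\<And>e. e \<in> A \<Longrightarrow> f e \<in> orthant d) \<Longrightarrow> sum f A \<in> orthant d"
  by (induction A rule: infinite_finite_induct) auto

lemma orthant_nonneg: "x \<in> orthant d \<Longrightarrow> 0 \<le> x"
  by (auto simp: orthant_iff le_fun_def)

lemma dot_add: "dot d p (x + y) = dot d p x + dot d p y"
  by (simp add: dot_def sum.distrib algebra_simps)

lemma sum_fun_apply: "sum f A i = (\<Sum>e\<in>A. f e i)"
  for f :: "'b \<Rightarrow> 'a \<Rightarrow> real"
  by (induction A rule: infinite_finite_induct) auto

lemma dot_sum: "dot d p (sum f A) = (\<Sum>e\<in>A. dot d p (f e))"
  unfolding dot_def sum_fun_apply sum_distrib_left by (rule sum.swap)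

lemma dot_combination:
  "dot d p (\<lambda>i. (1 - t) * x i + t * y i) = (1 - t) * dot d p x + t * dot d p y"
proof -
  have "(\<Sum>i<d. p i * ((1 - t) * x i + t * y i)) =
      (\<Sum>i<d. (1 - t) * (p i * x i) + t * (p i * y i))"
    by (rule sum.cong) (simp_all add: algebra_simps)
  then show ?thesis
    by (simp add: dot_def sum.distrib sum_distrib_left)
qed

definition axis_point :: "nat \<Rightarrow> real \<Rightarrow> nat \<Rightarrow> real" where
  "axis_point i z = (\<lambda>j. if j = i then z else 0)"

lemma axis_point_in_orthant [simp]: "i < d \<Longrightarrow> 0 \<le> z \<Longrightarrow> axis_point i z \<in> orthant d"
  by (auto simp: axis_point_def orthant_iff)

lemma dot_axis_point: "i < d \<Longrightarrow> dot d p (axis_point i z) = p i * z"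
  by (simp add: dot_def axis_point_def if_distrib cong: if_cong)

section \<open>Continuity and compactness for maximising over boxes\<close>

text \<open>Convexity alone gives continuity only in the interior; the gradient relative to the
  orthant gives it up to the boundary, where loads may lie.\<close>

lemma continuous_on_differentiable_cost:
  assumes "differentiable_cost d g"
  shows "continuous_on (orthant d) g"
  unfolding continuous_on_def
proof
  fix x assume x: "x \<in> orthant d"
  obtain p where p: "has_gradient d g p x"
    using assms x by (auto simp: differentiable_cost_def)
  let ?N = "\<lambda>y. L2_set (\<lambda>i. y i - x i) {..<d}" and ?D = "\<lambda>y. dot d p (\<lambda>i. y i - x i)"
  let ?F = "at x within orthant d"
  obtain \<delta> where \<delta>: "\<delta> > 0"
    "\<And>y. y \<in> orthant d \<Longrightarrow> ?N y < \<delta> \<Longrightarrow> \<bar>g y - g x - ?D y\<bar> \<le> 1 * ?N y"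
    using p unfolding has_gradient_def by (metis zero_less_one)
  have coord: "((\<lambda>y. y i) \<longlongrightarrow> x i) ?F" for i
    using continuous_on_product_coordinates[of i]
    by (auto simp: continuous_on_def intro: tendsto_within_subset[of _ _ x UNIV])
  have N: "(?N \<longlongrightarrow> 0) ?F"
    unfolding L2_set_def by (rule tendsto_eq_intros coord refl | simp)+
  have D: "(?D \<longlongrightarrow> 0) ?F"
    unfolding dot_def by (rule tendsto_eq_intros coord refl | simp)+
  have dom: "\<forall>\<^sub>F y in ?F. y \<in> orthant d"
    by (simp add: eventually_at_filter)
  have "\<forall>\<^sub>F y in ?F. norm (g y - g x - ?D y) \<le> ?N y"
    using order_tendstoD(2)[OF N \<delta>(1)] dom
  proof eventually_elim
    case (elim y)
    then show ?case using \<delta>(2)[of y] by simp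
  qed
  then have "((\<lambda>y. g y - g x - ?D y) \<longlongrightarrow> 0) ?F"
    by (rule Lim_null_comparison) (rule N)
  from tendsto_add[OF this D] show "(g \<longlongrightarrow> g x) ?F"
    by (simp add: LIM_zero_iff)
qed

text \<open>Coordinates from \<open>d\<close> on give degenerate intervals, so the box is a full
  product of compact intervals and Tychonoff's theorem applies.\<close>

lemma compact_orthant_box:
  assumes "y \<in> orthant d"
  shows "compact {x \<in> orthant d. x \<le> y}"
proof -
  have "{x \<in> orthant d. x \<le> y} = PiE UNIV (\<lambda>i. {0..y i})"
    using assms by (auto simp: orthant_iff le_fun_def PiE_def Pi_def) (metis order_antisym)
  moreover have "compactin euclidean (PiE UNIV (\<lambda>i. {0..y i}))"
    unfolding euclidean_product_topology[symmetric] by (subst compactin_PiE) simp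
  ultimately show ?thesis
    by simp
qed

section \<open>Increasing increments and superadditivity\<close>

locale supermodular_cost =
  fixes d :: nat and g :: "(nat \<Rightarrow> real) \<Rightarrow> real"
  assumes nonneg: "x \<in> orthant d \<Longrightarrow> 0 \<le> g x"
    and convex: "convex_cost d g"
    and strict: "strictly_convex_cost d g"
    and supermod: "supermodular d g"
    and cont: "continuous_on (orthant d) g"
    and zero [simp]: "g 0 = 0"
begin

text \<open>Raising the other coordinates is handled by supermodularity, raising coordinate
  \<open>i\<close> itself by convexity; \<open>a'\<close> is the corner between the two
  moves.\<close>

lemma increment_coordinate_mono:
  assumes a: "a \<in> orthant d" and b: "b \<in> orthant d" and ab: "a \<le> b" and i: "i < d" and c: "0 \<le> c"
  shows "g (a(i := a i + c)) - g a \<le> g (b(i := b i + c)) - g b"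
proof -
  define a' where "a' = a(i := b i)"
  have le: "a j \<le> b j" for j
    using ab by (simp add: le_fun_def)
  have nn: "0 \<le> a j" "0 \<le> b j" for j
    using a b by (auto simp: orthant_iff)
  have upd: "x(i := z) \<in> orthant d" if "x \<in> orthant d" "0 \<le> z" for x z
    using that i by (auto simp: orthant_iff)
  have "g (a'(i := b i + c)) + g b \<le> g (inf (a'(i := b i + c)) b) + g (sup (a'(i := b i + c)) b)"
    using supermod b c nn upd[OF upd[OF a]] by (auto simp: supermodular_def a'_def)
  moreover have "inf (a'(i := b i + c)) b = a'"
    using le c by (auto simp: fun_eq_iff a'_def inf_real_def min_def)
  moreover have "sup (a'(i := b i + c)) b = b(i := b i + c)"
    using le c by (auto simp: fun_eq_iff a'_def sup_real_def max_def)
  ultimately have 1: "g (a(i := b i + c)) - g (a(i := b i)) \<le> g (b(i := b i + c)) - g b"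
    by (simp add: a'_def)
  have 2: "g (a(i := a i + c)) - g a \<le> g (a(i := b i + c)) - g (a(i := b i))"
  proof (cases "b i + c = a i")
    case True
    with le[of i] c have "c = 0" "b i = a i" by auto
    then show ?thesis by simp
  next
    case False
    \<comment> \<open>On the segment from \<open>a\<close> to \<open>a(i := b i + c)\<close>, the
      parameters \<open>\<theta>\<close> and \<open>1 - \<theta>\<close> give
      \<open>a(i := a i + c)\<close> and \<open>a(i := b i)\<close>. The two convexity inequalities
      add up to the claim.\<close>
    define L where "L = b i + c - a i"
    define \<theta> where "\<theta> = c / L"
    have L: "L > 0"
      using False le[of i] c by (auto simp: L_def)
    have \<theta>: "0 \<le> \<theta>" "\<theta> \<le> 1"
      using L c le[of i] by (auto simp: \<theta>_def field_simps) (simp add: L_def)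
    have \<theta>L: "\<theta> * L = c"
      using L by (simp add: \<theta>_def)
    have conv: "g (\<lambda>j. (1 - t) * a j + t * (a(i := b i + c)) j)
        \<le> (1 - t) * g a + t * g (a(i := b i + c))" if "0 \<le> t" "t \<le> 1" for t
      using convex[unfolded convex_cost_def, rule_format, OF a upd[OF a], of "b i + c" t] nn c that
      by (metis add_nonneg_nonneg)
    have e1: "(\<lambda>j. (1 - \<theta>) * a j + \<theta> * (a(i := b i + c)) j) = a(i := a i + c)"
      using \<theta>L by (auto simp: fun_eq_iff L_def algebra_simps)
    have e2: "(\<lambda>j. (1 - (1 - \<theta>)) * a j + (1 - \<theta>) * (a(i := b i + c)) j) = a(i := b i)"
      using \<theta>L by (auto simp: fun_eq_iff L_def algebra_simps)
    show ?thesis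
      using conv[of \<theta>] conv[of "1 - \<theta>"] \<theta> unfolding e1 e2 by (simp add: algebra_simps)
  qed
  from 1 2 show ?thesis by simp
qed

lemma increment_mono:
  assumes a: "a \<in> orthant d" and b: "b \<in> orthant d" and ab: "a \<le> b" and c: "c \<in> orthant d"
  shows "g (a + c) - g a \<le> g (b + c) - g b"
proof -
  define T where "T m = (\<lambda>j. if j < m then c j else 0)" for m
  have T: "T m \<in> orthant d" for m
    using c by (auto simp: T_def orthant_iff)
  have step: "x + T (Suc m) = (x + T m)(m := (x + T m) m + c m)" for x m
    by (auto simp: T_def fun_eq_iff less_Suc_eq)
  define G where "G x m = g (x + T m)" for x m
  have T0: "T 0 = 0" by (simp add: T_def zero_fun_def)
  have "m \<le> d \<Longrightarrow> G a m - g a \<le> G b m - g b" for m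
  proof (induction m)
    case 0
    show ?case by (simp add: G_def T0)
  next
    case (Suc m)
    have "G a (Suc m) - G a m \<le> G b (Suc m) - G b m"
      unfolding G_def step using Suc.prems a b T ab c
      by (intro increment_coordinate_mono) (auto simp: orthant_iff le_fun_def)
    with Suc show ?case by simp
  qed
  from this[of d] have "g (a + T d) - g a \<le> g (b + T d) - g b" by (simp add: G_def)
  moreover have "T d = c"
    using c by (auto simp: T_def orthant_iff fun_eq_iff)
  ultimately show ?thesis by simp
qed

lemma superadditive: "a \<in> orthant d \<Longrightarrow> b \<in> orthant d \<Longrightarrow> g a + g b \<le> g (a + b)"
  using increment_mono[of 0 a b] orthant_nonneg[of a d] by simp

lemma sum_axis_points_le:
  assumes "x \<in> orthant d"
  shows "(\<Sum>i<d. g (axis_point i (x i))) \<le> g x"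
proof -
  define T where "T m = (\<lambda>j. if j < m then x j else 0)" for m
  have T: "T m \<in> orthant d" for m
    using assms by (auto simp: T_def orthant_iff)
  define G where "G m = g (T m)" for m
  have T0: "T 0 = 0" by (simp add: T_def zero_fun_def)
  have "m \<le> d \<Longrightarrow> (\<Sum>i<m. g (axis_point i (x i))) \<le> G m" for m
  proof (induction m)
    case 0
    show ?case by (simp add: G_def T0)
  next
    case (Suc m)
    have "T (Suc m) = T m + axis_point m (x m)"
      by (auto simp: T_def axis_point_def fun_eq_iff less_Suc_eq)
    moreover have "axis_point m (x m) \<in> orthant d"
      using assms Suc.prems by (simp add: orthant_iff axis_point_def)
    ultimately have "G m + g (axis_point m (x m)) \<le> G (Suc m)"
      unfolding G_def by (metis superadditive T)
    with Suc show ?case by simp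
  qed
  from this[of d] have "(\<Sum>i<d. g (axis_point i (x i))) \<le> g (T d)" by (simp add: G_def)
  also have "T d = x"
    using assms by (auto simp: T_def orthant_iff fun_eq_iff)
  finally show ?thesis .
qed


subsection \<open>Prices\<close>

text \<open>
  The price vector of scale \<open>\<tau>\<close>: coordinate \<open>i\<close> is the largest \<open>q\<close> for which the conjugate of the
  restriction of \<open>g\<close> to the \<open>i\<close>-th axis is at most \<open>\<tau>\<close> at \<open>q\<close>. This conjugate need not reach
  \<open>\<tau>\<close>, as it jumps to infinity if the restriction grows only linearly.
\<close>

definition price :: "real \<Rightarrow> nat \<Rightarrow> real" where
  "price \<tau> i = (INF z\<in>{0<..}. (g (axis_point i z) + \<tau>) / z)"

definition surplus :: "real \<Rightarrow> (nat \<Rightarrow> real) \<Rightarrow> real" where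
  "surplus \<tau> y = dot d (price \<tau>) y - g y"

definition saturated :: "real \<Rightarrow> (nat \<Rightarrow> real) \<Rightarrow> bool" where
  "saturated \<tau> y \<longleftrightarrow>
     y \<in> orthant d \<and> (\<forall>x\<in>orthant d. x \<le> y \<longrightarrow> surplus \<tau> x \<le> surplus \<tau> y)"

lemma price_le:
  assumes i: "i < d" and "0 \<le> z" "0 \<le> \<tau>"
  shows "price \<tau> i * z \<le> g (axis_point i z) + \<tau>"
proof (cases "z = 0")
  case True
  then show ?thesis using assms nonneg[of "axis_point i 0"] by simp
next
  case False
  have "bdd_below ((\<lambda>z. (g (axis_point i z) + \<tau>) / z) ` {0<..})"
    using assms by (intro bdd_belowI[of _ 0]) (auto intro!: divide_nonneg_pos add_nonneg_nonneg nonneg)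
  then have "price \<tau> i \<le> (g (axis_point i z) + \<tau>) / z"
    unfolding price_def using False assms by (intro cINF_lower) auto
  then show ?thesis
    using False assms by (simp add: field_simps)
qed

lemma price_approx:
  assumes "\<epsilon> > 0"
  obtains z where "z > 0" "g (axis_point i z) + \<tau> < (price \<tau> i + \<epsilon>) * z"
proof -
  have "\<exists>q\<in>(\<lambda>z. (g (axis_point i z) + \<tau>) / z) ` {0<..}. q < price \<tau> i + \<epsilon>"
    using assms unfolding price_def by (intro cInf_lessD) (auto intro: exI[of _ 1])
  then show ?thesis
    using that by (auto simp: field_simps)
qed

lemma surplus_zero [simp]: "surplus \<tau> 0 = 0"
  by (simp add: surplus_def dot_def)

text \<open>Each axis yields at most \<open>\<tau>\<close> by the choice of its price, and
  superadditivity makes \<open>g x\<close> at least the sum of the axis costs.\<close>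

lemma surplus_le:
  assumes "x \<in> orthant d" "0 \<le> \<tau>"
  shows "surplus \<tau> x \<le> real d * \<tau>"
proof -
  have "dot d (price \<tau>) x \<le> (\<Sum>i<d. g (axis_point i (x i)) + \<tau>)"
    unfolding dot_def using assms by (intro sum_mono price_le) (auto simp: orthant_iff)
  with sum_axis_points_le[OF assms(1)] show ?thesis
    by (simp add: surplus_def sum.distrib)
qed

lemma surplus_subadditive:
  "a \<in> orthant d \<Longrightarrow> b \<in> orthant d \<Longrightarrow> surplus \<tau> (a + b) \<le> surplus \<tau> a + surplus \<tau> b"
  using superadditive[of a b] by (simp add: surplus_def dot_add)

lemma saturated_nonneg: "saturated \<tau> y \<Longrightarrow> 0 \<le> surplus \<tau> y"
  using orthant_nonneg[of y d] zero_in_orthant[of d] unfolding saturated_def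
  by (metis surplus_zero)

text \<open>Removing \<open>c = z - x\<close> from \<open>y\<close> cannot raise the surplus, and
  \<open>c\<close> costs no more on top of \<open>x\<close> than on top of \<open>y - c\<close>; so
  adding \<open>c\<close> pays at \<open>x\<close> as well.\<close>

lemma saturated_antimono:
  assumes y: "saturated \<tau> y" and z: "z \<in> orthant d" "z \<le> y"
  shows "saturated \<tau> z"
  unfolding saturated_def
proof (intro conjI ballI impI z(1))
  fix x assume x: "x \<in> orthant d" "x \<le> z"
  define c where "c = z - x"
  have c: "c \<in> orthant d"
    unfolding c_def using x z by (intro diff_in_orthant)
  have cy: "c \<le> y"
    using z(2) orthant_nonneg[OF x(1)] by (auto simp: c_def le_fun_def) (smt (verit))
  have yc: "y - c \<in> orthant d"
    using y c cy by (intro diff_in_orthant) (auto simp: saturated_def)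
  have "x \<le> y - c"
    using z by (auto simp: c_def le_fun_def)
  from increment_mono[OF x(1) yc this c] have "g z - g x \<le> g y - g (y - c)"
    by (simp add: c_def algebra_simps)
  moreover have "surplus \<tau> (y - c) \<le> surplus \<tau> y"
    using y yc orthant_nonneg[OF c] by (auto simp: saturated_def le_fun_def)
  moreover have "dot d (price \<tau>) z = dot d (price \<tau>) x + dot d (price \<tau>) c"
    "dot d (price \<tau>) y = dot d (price \<tau>) (y - c) + dot d (price \<tau>) c"
    by (simp_all add: dot_add[symmetric] c_def)
  ultimately show "surplus \<tau> x \<le> surplus \<tau> z"
    by (simp add: surplus_def)
qed

text \<open>
  Let \<open>x\<close> maximise the surplus on the box below \<open>y\<close>. If \<open>x\<^sub>i < y\<^sub>i\<close>, the segment from \<open>x\<close> to any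
  point on the \<open>i\<close>-th axis starts inside the box, so by concavity that point has no larger surplus.
  The points of almost optimal surplus per unit may escape to infinity; then \<open>x\<close> could be moved
  in direction \<open>i\<close> without loss, against the uniqueness of the maximiser.
\<close>

lemma surplus_ge_of_not_saturated:
  assumes y: "y \<in> orthant d" and ns: "\<not> saturated \<tau> y"
  obtains x where "x \<in> orthant d" "x \<le> y" "\<tau> \<le> surplus \<tau> x"
proof -
  let ?B = "{x \<in> orthant d. x \<le> y}"
  have "continuous_on ?B (surplus \<tau>)"
    unfolding surplus_def dot_def
    by (intro continuous_intros continuous_on_subset[OF cont]
        continuous_on_subset[OF continuous_on_product_coordinates]) auto
  with compact_orthant_box[OF y] y obtain x where x: "x \<in> orthant d" "x \<le> y"
    and max: "\<And>x'. x' \<in> orthant d \<Longrightarrow> x' \<le> y \<Longrightarrow> surplus \<tau> x' \<le> surplus \<tau> x"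
    using continuous_attains_sup[of ?B "surplus \<tau>"] by auto
  have "x \<noteq> y"
    using ns y max by (auto simp: saturated_def)
  then obtain i where "x i \<noteq> y i" by (meson ext)
  with le_funD[OF x(2), of i] have xi: "x i < y i"
    by simp
  have i: "i < d"
  proof (rule ccontr)
    assume "\<not> i < d"
    with xi y x(1) show False by (simp add: orthant_iff)
  qed
  have nn: "0 \<le> x j" "x j \<le> y j" for j
    using x by (auto simp: orthant_iff le_fun_def)
  have "\<tau> \<le> surplus \<tau> x"
  proof (rule ccontr)
    assume neg: "\<not> \<tau> \<le> surplus \<tau> x"
    define t where "t = y i - x i"
    define h where "h = surplus \<tau> x"
    \<comment> \<open>\<open>q s\<close> shrinks \<open>x\<close> and then uses the full slack
      \<open>t\<close> on axis \<open>i\<close>, which stays in the box. For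
      \<open>s = t / z\<close> it lies on the segment from \<open>x\<close> to
      \<open>axis_point i z\<close>.\<close>
    define q where "q s = (\<lambda>j. (1 - s) * x j + axis_point i t j)" for s
    have t: "t > 0" and h: "h < \<tau>"
      using xi neg by (auto simp: t_def h_def)
    have q_in: "q s \<in> orthant d" "q s \<le> y" if "0 \<le> s" "s \<le> 1" for s
    proof -
      show "q s \<in> orthant d"
        using that x(1) t i by (auto simp: q_def orthant_iff axis_point_def)
      have "(1 - s) * x j \<le> x j" for j
        using that nn(1)[of j] by (simp add: mult_left_le_one_le)
      then show "q s \<le> y"
        using nn(2) by (auto simp: q_def le_fun_def axis_point_def t_def intro: order_trans)
    qed
    have move: "(1 - s) * surplus \<tau> x + s * surplus \<tau> (axis_point i z)
        \<le> surplus \<tau> (\<lambda>j. (1 - s) * x j + s * axis_point i z j)" if "0 \<le> s" "s \<le> 1" "0 \<le> z" for s z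
    proof -
      have "g (\<lambda>j. (1 - s) * x j + s * axis_point i z j) \<le> (1 - s) * g x + s * g (axis_point i z)"
        using convex x(1) i that by (auto simp: convex_cost_def)
      then show ?thesis
        unfolding surplus_def dot_combination right_diff_distrib by linarith
    qed
    have key: "\<exists>s. 0 < s \<and> s \<le> 1 / real (Suc k) \<and> h - (\<tau> - h) / real (Suc k) \<le> surplus \<tau> (q s)" for k
    proof -
      \<comment> \<open>Small enough that \<open>\<tau> - h \<le> \<epsilon> * z\<close> pushes
        \<open>z\<close> beyond \<open>Suc k * (t + 1)\<close>, so that \<open>s = t / z\<close>
        tends to 0, and that the loss \<open>\<epsilon> * t\<close> vanishes with growing
        \<open>k\<close>.\<close>
      define \<epsilon> where "\<epsilon> = (\<tau> - h) / (real (Suc k) * (t + 1))"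
      have \<epsilon>: "\<epsilon> > 0" using t h by (simp add: \<epsilon>_def)
      obtain z where z: "z > 0" "g (axis_point i z) + \<tau> < (price \<tau> i + \<epsilon>) * z"
        using price_approx[OF \<epsilon>] .
      then have sz: "\<tau> - \<epsilon> * z \<le> surplus \<tau> (axis_point i z)"
        using i by (simp add: surplus_def dot_axis_point algebra_simps)
      have z_ge: "\<tau> - h \<le> \<epsilon> * z"
      proof -
        define s where "s = min 1 (t / z)"
        have s: "0 < s" "s \<le> 1" "s * z \<le> t"
          using z(1) t by (auto simp: s_def min_def field_simps)
        let ?x = "\<lambda>j. (1 - s) * x j + s * axis_point i z j"
        have "(1 - s) * x j \<le> x j" for j
          using s nn(1)[of j] by (simp add: mult_left_le_one_le)
        then have "?x \<le> y"
          using nn(2) s(3) by (auto simp: le_fun_def axis_point_def t_def intro: order_trans)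
            (smt (verit))
        moreover have "?x \<in> orthant d"
          using s z(1) x(1) i by (auto simp: orthant_iff axis_point_def)
        ultimately have "surplus \<tau> ?x \<le> h"
          using max by (simp add: h_def)
        with move[OF less_imp_le[OF s(1)] s(2) less_imp_le[OF z(1)]]
        have "s * surplus \<tau> (axis_point i z) \<le> s * h"
          unfolding h_def left_diff_distrib by linarith
        with s have "surplus \<tau> (axis_point i z) \<le> h" by simp
        with sz show ?thesis by simp
      qed
      have zt: "real (Suc k) * (t + 1) \<le> z"
      proof -
        have D: "0 < real (Suc k) * (t + 1)"
          using t by simp
        have "(\<tau> - h) * 1 \<le> (\<tau> - h) * (z / (real (Suc k) * (t + 1)))"
          using z_ge by (simp add: \<epsilon>_def)
        then have "1 \<le> z / (real (Suc k) * (t + 1))"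
          using h by (subst (asm) mult_le_cancel_left_pos) auto
        with D show ?thesis
          by (simp only: le_divide_eq_1_pos)
      qed
      define s where "s = t / z"
      have "real (Suc k) * t \<le> z"
        using zt t by (simp add: algebra_simps)
      then have s: "0 < s" "s \<le> 1 / real (Suc k)"
        using t z(1) by (auto simp: s_def field_simps)
      moreover have "1 / real (Suc k) \<le> 1"
        by simp
      ultimately have s1: "s \<le> 1"
        by linarith
      have qs: "q s = (\<lambda>j. (1 - s) * x j + s * axis_point i z j)"
        using z(1) by (auto simp: q_def s_def axis_point_def fun_eq_iff)
      have "s * (\<tau> - \<epsilon> * z) \<le> s * surplus \<tau> (axis_point i z)"
        using sz s by simp
      then have "(1 - s) * h + s * (\<tau> - \<epsilon> * z) \<le> surplus \<tau> (q s)"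
        using move[OF less_imp_le[OF s(1)] s1 less_imp_le[OF z(1)]] unfolding h_def qs by linarith
      moreover have "h + s * (\<tau> - h) - \<epsilon> * t = (1 - s) * h + s * (\<tau> - \<epsilon> * z)"
        using z(1) by (simp add: s_def field_simps)
      moreover have "0 \<le> s * (\<tau> - h)"
        using s h by simp
      moreover have "\<epsilon> * t \<le> (\<tau> - h) / real (Suc k)"
      proof -
        have "\<epsilon> * t = (\<tau> - h) / real (Suc k) * (t / (t + 1))"
          by (simp add: \<epsilon>_def)
        also have "\<dots> \<le> (\<tau> - h) / real (Suc k)"
          using t h by (intro mult_left_le) auto
        finally show ?thesis .
      qed
      ultimately show ?thesis
        using s by (intro exI[of _ s]) auto
    qed
    then obtain s where s: "\<And>k. 0 < s k" "\<And>k. s k \<le> 1 / real (Suc k)"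
      "\<And>k. h - (\<tau> - h) / real (Suc k) \<le> surplus \<tau> (q (s k))"
      by metis
    have "1 / real (Suc k) \<le> 1" for k
      by simp
    then have s1: "s k \<le> 1" for k
      using s(2)[of k] order_trans by blast
    have lim0: "(\<lambda>k. c / real (Suc k)) \<longlonglongrightarrow> 0" for c :: real
      using tendsto_mult[OF tendsto_const[of c] LIMSEQ_inverse_real_of_nat] by (simp add: divide_inverse)
    have "s \<longlonglongrightarrow> 0"
      by (rule tendsto_sandwich[OF _ _ tendsto_const lim0[of 1]])
        (rule always_eventually, use s(1,2) less_imp_le in blast)+
    moreover have cq: "continuous_on {0..1} (\<lambda>r. surplus \<tau> (q r))"
    proof -
      have "continuous_on {0..1} q"
        unfolding q_def by (intro continuous_on_coordinatewise_then_product continuous_intros)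
      then have "continuous_on {0..1} (\<lambda>r. g (q r))"
        using q_in(1) by (intro continuous_on_compose2[OF cont]) auto
      then show ?thesis
        unfolding surplus_def dot_def by (intro continuous_intros) (auto simp: q_def intro!: continuous_intros)
    qed
    ultimately have lim: "(\<lambda>k. surplus \<tau> (q (s k))) \<longlonglongrightarrow> surplus \<tau> (q 0)"
      using less_imp_le[OF s(1)] s1 by (intro continuous_on_tendsto_compose[OF cq]) auto
    have "(\<lambda>k. h - (\<tau> - h) / real (Suc k)) \<longlonglongrightarrow> h - 0"
      by (intro tendsto_diff tendsto_const lim0)
    from LIMSEQ_le[OF this lim] have q0: "h \<le> surplus \<tau> (q 0)"
      using s(3) by simp
    \<comment> \<open>\<open>q 0\<close> is \<open>x\<close> with coordinate \<open>i\<close> raised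
      to \<open>y i\<close>, hence a second maximiser in the box; strict convexity would give their
      midpoint a larger surplus.\<close>
    let ?m = "\<lambda>j. (1 - 1/2) * x j + 1/2 * q 0 j"
    have m: "?m \<in> orthant d"
      using q_in(1)[of 0] x(1) by (simp add: orthant_iff)
    have "?m \<le> y"
    proof (rule le_funI)
      fix j
      show "?m j \<le> y j"
        using le_funD[OF q_in(2)[of 0], of j] nn(2)[of j] by simp
    qed
    with max m have "surplus \<tau> ?m \<le> h"
      by (simp add: h_def)
    moreover have "x \<noteq> q 0"
    proof
      assume "x = q 0"
      then have "x i = q 0 i" by (rule arg_cong)
      with t show False by (simp add: q_def axis_point_def)
    qed
    then have "g ?m < (1 - 1/2) * g x + 1/2 * g (q 0)"
      using strict[unfolded strictly_convex_cost_def, rule_format, OF x(1) q_in(1), of 0 "1/2"] by simp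
    moreover have "surplus \<tau> ?m = (1 - 1/2) * (h + g x) + 1/2 * (surplus \<tau> (q 0) + g (q 0)) - g ?m"
      unfolding surplus_def dot_combination h_def by simp
    ultimately show False
      using q0 by argo
  qed
  with that x show ?thesis by blast
qed

end

subsection \<open>Profits\<close>

locale cost_instance = supermodular_cost +
  fixes n :: nat and v :: "nat \<Rightarrow> real" and s :: "nat \<Rightarrow> nat \<Rightarrow> real"
  assumes valid: "valid_instance d n v s"
begin

abbreviation value_of :: "nat set \<Rightarrow> real" where
  "value_of \<equiv> profit g v s"

definition residual :: "real \<Rightarrow> nat \<Rightarrow> real" where
  "residual \<tau> e = v e - dot d (price \<tau>) (s e)"

lemma size_in_orthant [simp]: "e < n \<Longrightarrow> s e \<in> orthant d"
  using valid by (simp add: valid_instance_def)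

lemma load_in_orthant [simp]: "A \<subseteq> {..<n} \<Longrightarrow> sum s A \<in> orthant d"
  by (intro sum_in_orthant) auto

lemma load_mono: "A \<subseteq> B \<Longrightarrow> B \<subseteq> {..<n} \<Longrightarrow> sum s A \<le> sum s B"
proof (rule le_funI)
  fix i assume AB: "A \<subseteq> B" "B \<subseteq> {..<n}"
  have "0 \<le> s e i" if "e \<in> B" for e
    using size_in_orthant[of e] AB that by (auto simp: orthant_iff)
  then show "sum s A i \<le> sum s B i"
    unfolding sum_fun_apply using AB finite_subset[OF AB(2)] by (intro sum_mono2) auto
qed

lemma profit_eq: "value_of A = sum v A - g (sum s A)"
  by (simp add: profit_def sum_fun_apply[symmetric])

lemma profit_singleton: "value_of {e} = v e - g (s e)"
  by (simp add: profit_eq)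

lemma profit_empty [simp]: "value_of {} = 0"
  by (simp add: profit_eq)

text \<open>The Lagrangian split: the price terms cancel, leaving a part additive over the items and
  a part that sees only the load.\<close>

lemma profit_residual: "value_of A = sum (residual \<tau>) A + surplus \<tau> (sum s A)"
  by (simp add: profit_eq residual_def surplus_def dot_sum sum_subtractf)

text \<open>Submodularity of the profit as a set function, inherited from the increasing increments
  of \<open>g\<close>.\<close>

lemma marginal_antimono:
  assumes "A \<subseteq> B" "B \<subseteq> {..<n}" "e < n" "e \<notin> B"
  shows "value_of (insert e B) - value_of B \<le> value_of (insert e A) - value_of A"
proof -
  have fin: "finite A" "finite B" "e \<notin> A" "A \<subseteq> {..<n}"
    using assms by (meson finite_lessThan finite_subset subset_trans subsetD)+
  have "g (sum s A + s e) - g (sum s A) \<le> g (sum s B + s e) - g (sum s B)"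
    using assms fin by (intro increment_mono load_mono) auto
  then show ?thesis
    using assms fin by (simp add: profit_eq add.commute)
qed

lemma profit_union_le:
  assumes "A \<subseteq> {..<n}" "B \<subseteq> {..<n}" "A \<inter> B = {}"
  shows "value_of (A \<union> B) \<le> value_of A + value_of B"
proof -
  have fin: "finite A" "finite B"
    using assms(1,2) by (meson finite_lessThan finite_subset)+
  show ?thesis
    using superadditive[OF load_in_orthant[OF assms(1)] load_in_orthant[OF assms(2)]] fin assms
    by (simp add: profit_eq sum.union_disjoint)
qed

lemma profit_le_sum_singletons:
  assumes "A \<subseteq> {..<n}"
  shows "value_of A \<le> (\<Sum>e\<in>A. value_of {e})"
proof -
  have "finite A" using assms by (meson finite_lessThan finite_subset)
  then show ?thesis
    using assms
  proof (induction A)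
    case (insert e A)
    then show ?case
      using profit_union_le[of "{e}" A] by auto
  qed simp
qed

lemma profit_telescope:
  assumes "A \<subseteq> {..<n}"
  shows "value_of A = (\<Sum>e\<in>A. value_of (A \<inter> {..e}) - value_of (A \<inter> {..<e}))"
proof -
  let ?w = "\<lambda>e. value_of (A \<inter> {..e}) - value_of (A \<inter> {..<e})"
  have "value_of (A \<inter> {..<m}) = sum ?w (A \<inter> {..<m})" for m
  proof (induction m)
    case (Suc m)
    show ?case
    proof (cases "m \<in> A")
      case True
      then have "A \<inter> {..<Suc m} = insert m (A \<inter> {..<m})"
        by auto
      with Suc show ?thesis
        by (simp add: lessThan_Suc_atMost)
    next
      case False
      then have "A \<inter> {..<Suc m} = A \<inter> {..<m}"
        by (auto simp: less_Suc_eq)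
      with Suc show ?thesis by simp
    qed
  qed simp
  from this[of n] assms show ?thesis
    by (simp add: Int_absorb2)
qed

text \<open>
  Items whose size alone leaves the saturated region. Each of them contains a part of surplus at
  least \<open>\<tau>\<close>; if all of them are wanted and individually almost worthless, then they
  hardly interact, and these surpluses nearly add up.
\<close>

lemma card_unsaturated_le:
  assumes B: "B \<subseteq> {..<n}"
    and marg: "\<And>A e. A \<subseteq> B \<Longrightarrow> e \<in> B \<Longrightarrow> value_of A \<le> value_of (insert e A)"
    and M: "\<And>e. e \<in> B \<Longrightarrow> value_of {e} \<le> M"
    and unsat: "\<And>e. e \<in> B \<Longrightarrow> \<not> saturated \<tau> (s e)" and \<tau>: "0 \<le> \<tau>"
  shows "real (card B) * (\<tau> - M) \<le> real d * \<tau>"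
proof -
  have "\<exists>y. y \<in> orthant d \<and> y \<le> s e \<and> \<tau> \<le> surplus \<tau> y" if "e \<in> B" for e
    using surplus_ge_of_not_saturated[OF size_in_orthant unsat[OF that]] B that
    by (metis lessThan_iff subsetD)
  then obtain y where y: "\<And>e. e \<in> B \<Longrightarrow> y e \<in> orthant d" "\<And>e. e \<in> B \<Longrightarrow> y e \<le> s e"
    "\<And>e. e \<in> B \<Longrightarrow> \<tau> \<le> surplus \<tau> (y e)"
    by metis
  define S where "S A = surplus \<tau> (sum y A)" for A
  have fin: "finite B"
    using B by (meson finite_lessThan finite_subset)
  have "A \<subseteq> B \<Longrightarrow> real (card A) * (\<tau> - M) \<le> S A" if "finite A" for A
    using that
  proof (induction A)
    case empty
    show ?case by (simp add: S_def)
  next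
    case (insert e A)
    have e: "e < n" "e \<in> B" and AB: "A \<subseteq> B" "A \<subseteq> {..<n}"
      using insert.prems B by auto
    have yA: "sum y A \<in> orthant d" "sum y A \<le> sum s A"
      using AB y by (auto simp: le_fun_def sum_fun_apply intro!: sum_mono sum_in_orthant)
    \<comment> \<open>The interaction cost of \<open>sum y A\<close> and \<open>y e\<close> only
      grows when they are enlarged to \<open>sum s A\<close> and \<open>s e\<close>. There it equals
      \<open>value_of {e}\<close> minus the marginal value of \<open>e\<close>, which is at most
      \<open>M\<close>.\<close>
    have "g (sum y A + y e) - g (sum y A) \<le> g (sum s A + y e) - g (sum s A)"
      using yA y e AB by (intro increment_mono) auto
    moreover have "g (y e + sum s A) - g (y e) \<le> g (s e + sum s A) - g (s e)"
      using y e AB by (intro increment_mono) auto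
    moreover have "value_of A \<le> value_of (insert e A)" "value_of {e} \<le> M"
      using marg[OF AB(1) e(2)] M[OF e(2)] .
    moreover have "value_of (insert e A) - value_of A = v e - (g (s e + sum s A) - g (sum s A))"
      using insert.hyps by (simp add: profit_eq)
    ultimately have "g (sum y A + y e) - g (sum y A) - g (y e) \<le> M"
      unfolding profit_singleton by (simp only: add.commute[of "y e"])
    moreover have "S (insert e A) =
        S A + surplus \<tau> (y e) - (g (sum y A + y e) - g (sum y A) - g (y e))"
      using insert.hyps by (simp add: S_def surplus_def dot_add add.commute)
    moreover have "real (card (insert e A)) * (\<tau> - M) = real (card A) * (\<tau> - M) + (\<tau> - M)"
      using insert.hyps by (simp add: algebra_simps)
    ultimately show ?case
      using insert.IH AB(1) y(3)[OF e(2)] by linarith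
  qed
  from this[OF fin] have "real (card B) * (\<tau> - M) \<le> S B" by simp
  also have "\<dots> \<le> real d * \<tau>"
    unfolding S_def using y \<tau> by (intro surplus_le sum_in_orthant) auto
  finally show ?thesis .
qed

text \<open>
  \<open>B\<close> is what remains after greedily filling the saturated region with items of \<open>Y\<close> worth their
  price. If an item was rejected although it fits on its own, the region is full, which
  yields \<open>\<tau> - M\<close>. Otherwise \<open>B\<close> collects all the positive residuals, and Lagrangian
  duality applies.
\<close>

lemma maximal_saturated_profit:
  assumes Opt: "Opt \<subseteq> {..<n}"
    and marg: "\<And>A e. A \<subseteq> Opt \<Longrightarrow> e \<in> Opt \<Longrightarrow> value_of A \<le> value_of (insert e A)"
    and M: "\<And>e. e < n \<Longrightarrow> value_of {e} \<le> M" and M0: "0 \<le> M" "2 * M \<le> \<tau>" "0 < \<tau>"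
    and Y: "Y \<subseteq> {..<n}" and B: "B \<subseteq> Y"
    and res: "\<And>e. e \<in> B \<Longrightarrow> 0 \<le> residual \<tau> e" and sat: "saturated \<tau> (sum s B)"
    and maximal: "\<And>e. e \<in> Y - B \<Longrightarrow> 0 \<le> residual \<tau> e \<Longrightarrow> \<not> saturated \<tau> (sum s B + s e)"
  shows "\<tau> - M \<le> value_of B \<or> value_of (Opt \<inter> Y) \<le> value_of B + real d * \<tau> + 2 * real d * M"
proof (cases "\<exists>e\<in>Y - B. 0 \<le> residual \<tau> e \<and> saturated \<tau> (s e)")
  case True
  then obtain e where e: "e \<in> Y - B" "0 \<le> residual \<tau> e" "saturated \<tau> (s e)" by blast
  have en: "e < n"
    using e(1) Y by auto
  have BB: "sum s B \<in> orthant d"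
    using B Y by (intro load_in_orthant) (rule order_trans)
  obtain x where x: "x \<in> orthant d" "x \<le> sum s B + s e" "\<tau> \<le> surplus \<tau> x"
    using surplus_ge_of_not_saturated[OF add_in_orthant[OF BB size_in_orthant[OF en]] maximal[OF e(1,2)]] .
  \<comment> \<open>Splits \<open>x\<close> into a part below the load and a part below
    \<open>s e\<close>. Both bounds are saturated, so their surpluses dominate; that of
    \<open>s e\<close> is at most \<open>M\<close> because the residual of \<open>e\<close> is
    nonnegative.\<close>
  define a where "a = inf x (sum s B)"
  have a: "a \<in> orthant d" "a \<le> sum s B" "a \<le> x"
    using x(1) BB by (auto simp: a_def orthant_iff)
  have b: "x - a \<in> orthant d" "x - a \<le> s e"
  proof -
    show "x - a \<in> orthant d" using a x by (intro diff_in_orthant)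
    show "x - a \<le> s e"
    proof (rule le_funI)
      fix i
      have "x i \<le> sum s B i + s e i" "0 \<le> s e i"
        using le_funD[OF x(2), of i] size_in_orthant[OF en] by (simp_all add: orthant_iff)
      then show "(x - a) i \<le> s e i"
        by (simp add: a_def inf_real_def min_def)
    qed
  qed
  have "\<tau> \<le> surplus \<tau> a + surplus \<tau> (x - a)"
    using x(3) surplus_subadditive[OF a(1) b(1), of \<tau>] by simp
  also have "\<dots> \<le> surplus \<tau> (sum s B) + surplus \<tau> (s e)"
    using a b sat e(3) by (intro add_mono) (auto simp: saturated_def)
  also have "surplus \<tau> (s e) \<le> M"
    using M[OF en] e(2) by (simp add: profit_residual[of _ \<tau>])
  finally have "\<tau> - M \<le> surplus \<tau> (sum s B)" by simp
  also have "\<dots> \<le> value_of B"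
    using res by (simp add: profit_residual[of _ \<tau>] sum_nonneg)
  finally show ?thesis ..
next
  case False
  define G where "G = {e \<in> Opt \<inter> Y. saturated \<tau> (s e)}"
  define N where "N = Opt \<inter> Y - G"
  have GN: "G \<subseteq> {..<n}" "N \<subseteq> {..<n}" "G \<inter> N = {}" "Opt \<inter> Y = G \<union> N"
    using Opt by (auto simp: G_def N_def)
  have fB: "finite B" and fG: "finite G"
    using B Y GN(1) by (meson finite_lessThan finite_subset)+
  have "sum (residual \<tau>) G \<le> sum (residual \<tau>) (G \<inter> B)"
  proof -
    have "sum (residual \<tau>) (G - B) \<le> 0"
    proof (rule sum_nonpos)
      fix e assume "e \<in> G - B"
      then have "e \<in> Y - B" "saturated \<tau> (s e)"
        by (auto simp: G_def)
      with False show "residual \<tau> e \<le> 0"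
        by (metis linear)
    qed
    moreover have "sum (residual \<tau>) G = sum (residual \<tau>) (G \<inter> B) + sum (residual \<tau>) (G - B)"
      using fG by (rule sum.Int_Diff)
    ultimately show ?thesis by simp
  qed
  also have "\<dots> \<le> sum (residual \<tau>) B"
    using fB res by (intro sum_mono2) auto
  also have "\<dots> \<le> value_of B"
    using saturated_nonneg[OF sat] by (simp add: profit_residual[of _ \<tau>])
  finally have "value_of G \<le> value_of B + real d * \<tau>"
    using surplus_le[OF load_in_orthant[OF GN(1)], of \<tau>] M0 by (simp add: profit_residual[of _ \<tau>])
  moreover have "value_of N \<le> 2 * real d * M"
  proof -
    have card_le: "real (card N) * (\<tau> - M) \<le> real d * \<tau>"
    proof (rule card_unsaturated_le[OF GN(2)])
      show "value_of A \<le> value_of (insert e A)" if "A \<subseteq> N" "e \<in> N" for A e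
        using that by (intro marg) (auto simp: N_def)
      show "value_of {e} \<le> M" if "e \<in> N" for e
        using that GN M by blast
      show "\<not> saturated \<tau> (s e)" if "e \<in> N" for e
        using that by (auto simp: N_def G_def)
    qed (use M0(3) in simp)
    have "real (card N) * (\<tau> / 2) \<le> real (card N) * (\<tau> - M)"
      using M0 by (intro mult_left_mono) auto
    with card_le have "real (card N) * (\<tau> / 2) \<le> (2 * real d) * (\<tau> / 2)" by simp
    then have "real (card N) \<le> 2 * real d"
      using M0(3) by (subst (asm) mult_le_cancel_right_pos) auto
    then have "real (card N) * M \<le> 2 * real d * M"
      using M0(1) by (rule mult_right_mono)
    moreover have "(\<Sum>e\<in>N. value_of {e}) \<le> (\<Sum>e\<in>N. M)"
      using GN(2) M by (intro sum_mono) auto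
    ultimately show ?thesis
      using profit_le_sum_singletons[OF GN(2)] by simp
  qed
  ultimately show ?thesis
    using profit_union_le[OF GN(1-3)] unfolding GN(4) by linarith
qed

end

subsection \<open>Algorithms that first observe a sample\<close>

text \<open>\<open>hs\<close> ends with the current item, so \<open>k < length hs\<close> means that
  at least \<open>k\<close> items precede it: the first \<open>k\<close> arrivals are always
  rejected.\<close>

definition two_phase ::
    "nat \<Rightarrow> ((real \<times> (nat \<Rightarrow> real)) list \<Rightarrow> (real \<times> (nat \<Rightarrow> real)) list \<Rightarrow> real \<times> (nat \<Rightarrow> real) \<Rightarrow> bool)
      \<Rightarrow> online_alg" where
  "two_phase k D hs \<longleftrightarrow> k < length hs \<and> D (take k hs) (drop k (butlast hs)) (last hs)"

definition selected :: "('b list \<Rightarrow> 'b \<Rightarrow> bool) \<Rightarrow> ('a \<Rightarrow> 'b) \<Rightarrow> 'a list \<Rightarrow> 'a set" where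
  "selected D h ys = {ys ! j | j. j < length ys \<and> D (map h (take j ys)) (h (ys ! j))}"

text \<open>With the sample fixed, the second phase is a plain history-dependent rule on the
  remaining list, open to induction by appending items.\<close>

lemma accepted_two_phase:
  assumes "k \<le> length \<sigma>"
  shows "accepted (two_phase k D) v s \<sigma> =
    selected (D (map (\<lambda>e. (v e, s e)) (take k \<sigma>))) (\<lambda>e. (v e, s e)) (drop k \<sigma>)"
proof -
  let ?h = "\<lambda>e. (v e, s e)"
  have iff: "two_phase k D (map ?h (take (Suc m) \<sigma>)) \<longleftrightarrow>
      k \<le> m \<and> D (map ?h (take k \<sigma>)) (map ?h (take (m - k) (drop k \<sigma>))) (?h (\<sigma> ! m))"
    if m: "m < length \<sigma>" for m
    using m by (auto simp: two_phase_def take_Suc_conv_app_nth butlast_append take_map drop_map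
        drop_take min_def)
  show ?thesis
  proof (intro set_eqI iffI)
    fix x assume "x \<in> accepted (two_phase k D) v s \<sigma>"
    then obtain m where "x = \<sigma> ! m" "m < length \<sigma>" "two_phase k D (map ?h (take (Suc m) \<sigma>))"
      by (auto simp: accepted_def)
    with iff[of m] show "x \<in> selected (D (map ?h (take k \<sigma>))) ?h (drop k \<sigma>)"
      unfolding selected_def by (intro CollectI exI[of _ "m - k"]) auto
  next
    fix x assume "x \<in> selected (D (map ?h (take k \<sigma>))) ?h (drop k \<sigma>)"
    then obtain j where "x = drop k \<sigma> ! j" "j < length \<sigma> - k"
      "D (map ?h (take k \<sigma>)) (map ?h (take j (drop k \<sigma>))) (?h (drop k \<sigma> ! j))"
      by (auto simp: selected_def)
    with iff[of "k + j"] assms show "x \<in> accepted (two_phase k D) v s \<sigma>"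
      unfolding accepted_def by (intro CollectI exI[of _ "k + j"]) auto
  qed
qed

lemma selected_Nil [simp]: "selected D h [] = {}"
  by (simp add: selected_def)

lemma selected_snoc:
  "selected D h (ys @ [y]) = selected D h ys \<union> (if D (map h ys) (h y) then {y} else {})"
proof (intro set_eqI iffI)
  fix x assume "x \<in> selected D h (ys @ [y])"
  then obtain j where j: "x = (ys @ [y]) ! j" "j < Suc (length ys)"
    "D (map h (take j (ys @ [y]))) (h ((ys @ [y]) ! j))"
    by (auto simp: selected_def)
  show "x \<in> selected D h ys \<union> (if D (map h ys) (h y) then {y} else {})"
  proof (cases "j < length ys")
    case True
    with j have "x \<in> selected D h ys"
      by (auto simp: selected_def nth_append)
    then show ?thesis ..
  next
    case False
    with j(2) have "j = length ys" by simp
    with j show ?thesis by simp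
  qed
next
  fix x assume x: "x \<in> selected D h ys \<union> (if D (map h ys) (h y) then {y} else {})"
  show "x \<in> selected D h (ys @ [y])"
  proof (cases "x \<in> selected D h ys")
    case True
    then obtain j where "x = ys ! j" "j < length ys" "D (map h (take j ys)) (h (ys ! j))"
      by (auto simp: selected_def)
    then show ?thesis
      unfolding selected_def by (intro CollectI exI[of _ j]) (simp add: nth_append)
  next
    case False
    with x have "x = y" "D (map h ys) (h y)"
      by (auto split: if_splits)
    then show ?thesis
      unfolding selected_def by (intro CollectI exI[of _ "length ys"]) simp
  qed
qed

definition first_good :: "('b \<Rightarrow> bool) \<Rightarrow> 'b list \<Rightarrow> 'b \<Rightarrow> bool" where
  "first_good Q xs x \<longleftrightarrow> Q x \<and> (\<forall>x\<in>set xs. \<not> Q x)"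

lemma selected_first_good:
  "(\<forall>e\<in>set ys. \<not> Q (h e)) \<and> selected (first_good Q) h ys = {} \<or>
   (\<exists>e\<in>set ys. Q (h e) \<and> selected (first_good Q) h ys = {e})"
  by (induction ys rule: rev_induct) (auto simp: selected_snoc first_good_def)

section \<open>The greedy and secretary rules\<close>

context supermodular_cost
begin

definition worth_adding :: "real \<Rightarrow> (nat \<Rightarrow> real) \<Rightarrow> real \<times> (nat \<Rightarrow> real) \<Rightarrow> bool" where
  "worth_adding \<tau> l x \<longleftrightarrow> dot d (price \<tau>) (snd x) \<le> fst x \<and> saturated \<tau> (l + snd x)"

text \<open>Decisions are functions of the history, so the load is recomputed by replaying the
  earlier ones.\<close>

definition greedy_load :: "real \<Rightarrow> (real \<times> (nat \<Rightarrow> real)) list \<Rightarrow> nat \<Rightarrow> real" where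
  "greedy_load \<tau> xs = foldl (\<lambda>l x. if worth_adding \<tau> l x then l + snd x else l) 0 xs"

definition greedy :: "real \<Rightarrow> (real \<times> (nat \<Rightarrow> real)) list \<Rightarrow> real \<times> (nat \<Rightarrow> real) \<Rightarrow> bool" where
  "greedy \<tau> xs = worth_adding \<tau> (greedy_load \<tau> xs)"

text \<open>List positions stand in for the item names, which are not revealed.\<close>

definition sample_opt :: "(real \<times> (nat \<Rightarrow> real)) list \<Rightarrow> real" where
  "sample_opt xs = opt g (length xs) (\<lambda>i. fst (xs ! i)) (\<lambda>i. snd (xs ! i))"

text \<open>The divisor \<open>8 * d\<close> keeps \<open>d * \<tau>\<close> below
  \<open>opt / 8\<close>, half of what a balanced order leaves for the second phase.\<close>

definition greedy_alg :: "nat \<Rightarrow> online_alg" where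
  "greedy_alg k = two_phase k (\<lambda>sample. greedy (sample_opt sample / (8 * real d)))"

text \<open>The inserted 0 covers an empty sample and ensures that no item passing the threshold has
  negative profit.\<close>

definition threshold :: "(real \<times> (nat \<Rightarrow> real)) list \<Rightarrow> real" where
  "threshold xs = Max (insert 0 ((\<lambda>x. fst x - g (snd x)) ` set xs))"

text \<open>
  The strict rule fails if several items attain the maximum, the weak one if the second largest
  profit does: the former finds no item, the latter may stop at a wrong one.
\<close>

definition exceeds :: "bool \<Rightarrow> real \<Rightarrow> real \<times> (nat \<Rightarrow> real) \<Rightarrow> bool" where
  "exceeds weak c x \<longleftrightarrow> c < fst x - g (snd x) \<or> weak \<and> c = fst x - g (snd x)"

definition secretary_alg :: "bool \<Rightarrow> nat \<Rightarrow> online_alg" where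
  "secretary_alg weak k = two_phase k (\<lambda>sample. first_good (exceeds weak (threshold sample)))"

lemma saturated_zero: "saturated \<tau> 0"
  unfolding saturated_def
proof (intro conjI ballI impI)
  fix x assume "x \<in> orthant d" "x \<le> 0"
  then have "x = 0"
    using orthant_nonneg by (meson antisym)
  then show "surplus \<tau> x \<le> surplus \<tau> 0" by simp
qed simp

end

section \<open>The rules on a fixed arrival order\<close>

context cost_instance
begin

abbreviation item :: "nat \<Rightarrow> real \<times> (nat \<Rightarrow> real)" where
  "item \<equiv> \<lambda>e. (v e, s e)"

text \<open>The invariant \<open>R\<close> also ties the replayed load to the accepted set.
  Maximality survives an acceptance by \<open>saturated_antimono\<close>: what did not fit the
  smaller load does not fit the larger one.\<close>

lemma selected_greedy:
  fixes \<tau> :: real and ys :: "nat list"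
  defines "B \<equiv> selected (greedy \<tau>) item ys"
  assumes "distinct ys" "set ys \<subseteq> {..<n}"
  shows "B \<subseteq> set ys" "\<And>e. e \<in> B \<Longrightarrow> 0 \<le> residual \<tau> e" "saturated \<tau> (sum s B)"
    "\<And>e. e \<in> set ys - B \<Longrightarrow> 0 \<le> residual \<tau> e \<Longrightarrow> \<not> saturated \<tau> (sum s B + s e)"
proof -
  define S where "S ys = selected (greedy \<tau>) item ys" for ys
  define R where "R ys \<longleftrightarrow> S ys \<subseteq> set ys \<and> (\<forall>e\<in>S ys. 0 \<le> residual \<tau> e) \<and>
      greedy_load \<tau> (map item ys) = sum s (S ys) \<and> saturated \<tau> (sum s (S ys)) \<and>
      (\<forall>e\<in>set ys - S ys. 0 \<le> residual \<tau> e \<longrightarrow> \<not> saturated \<tau> (sum s (S ys) + s e))" for ys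
  have "R ys"
    using assms(2,3)
  proof (induction ys rule: rev_induct)
    case Nil
    have "S [] = {}" by (simp add: S_def)
    then show ?case
      by (simp add: R_def greedy_load_def saturated_zero)
  next
    case (snoc y ys)
    define L where "L = sum s (S ys)"
    have IH: "S ys \<subseteq> set ys" "\<forall>e\<in>S ys. 0 \<le> residual \<tau> e" "greedy_load \<tau> (map item ys) = L"
      "saturated \<tau> L" "\<forall>e\<in>set ys - S ys. 0 \<le> residual \<tau> e \<longrightarrow> \<not> saturated \<tau> (L + s e)"
      using snoc by (simp_all add: R_def L_def)
    have yn: "y < n" "y \<notin> S ys" "finite (S ys)"
      using snoc.prems IH(1) finite_subset by auto
    have dec: "greedy \<tau> (map item ys) (item y) \<longleftrightarrow> 0 \<le> residual \<tau> y \<and> saturated \<tau> (L + s y)"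
      by (simp add: greedy_def worth_adding_def IH(3) residual_def)
    have load: "greedy_load \<tau> (map item (ys @ [y])) =
        (if 0 \<le> residual \<tau> y \<and> saturated \<tau> (L + s y) then L + s y else L)"
      using IH(3) by (simp add: greedy_load_def worth_adding_def residual_def)
    show ?case
    proof (cases "0 \<le> residual \<tau> y \<and> saturated \<tau> (L + s y)")
      case True
      then have S': "S (ys @ [y]) = insert y (S ys)"
        using dec by (simp add: S_def selected_snoc)
      have sum': "sum s (S (ys @ [y])) = L + s y"
        using yn by (simp add: S' L_def add.commute)
      have "\<not> saturated \<tau> (L + s y + s e)" if "e \<in> set ys - S ys" "0 \<le> residual \<tau> e" for e
      proof
        assume sat: "saturated \<tau> (L + s y + s e)"
        have "e < n" "L \<in> orthant d"
          using that snoc.prems IH(4) by (auto simp: saturated_def)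
        moreover have "L + s e \<le> L + s y + s e"
          using orthant_nonneg[OF size_in_orthant[OF yn(1)]] by (simp add: le_fun_def)
        ultimately have "saturated \<tau> (L + s e)"
          using sat by (intro saturated_antimono[OF sat]) simp_all
        with IH(5) that show False by blast
      qed
      then show ?thesis
        unfolding R_def sum' load using True IH S' by auto
    next
      case False
      then have S': "S (ys @ [y]) = S ys"
        using dec by (auto simp: S_def selected_snoc)
      show ?thesis
        unfolding R_def S' load using False IH L_def by auto
    qed
  qed
  then show "B \<subseteq> set ys" "\<And>e. e \<in> B \<Longrightarrow> 0 \<le> residual \<tau> e" "saturated \<tau> (sum s B)"
    "\<And>e. e \<in> set ys - B \<Longrightarrow> 0 \<le> residual \<tau> e \<Longrightarrow> \<not> saturated \<tau> (sum s B + s e)"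
    unfolding R_def S_def B_def by blast+
qed

lemma selected_greedy_nonneg:
  assumes "distinct ys" "set ys \<subseteq> {..<n}"
  shows "0 \<le> value_of (selected (greedy \<tau>) item ys)"
  unfolding profit_residual[of _ \<tau>]
  using saturated_nonneg[OF selected_greedy(3)[OF assms]] selected_greedy(2)[OF assms]
  by (intro add_nonneg_nonneg sum_nonneg) auto

lemma sample_opt_eq:
  "sample_opt (map item zs) = Max (value_of ` Pow (set zs))" if "distinct zs"
proof -
  let ?v = "\<lambda>i. fst (map item zs ! i)" and ?s = "\<lambda>i. snd (map item zs ! i)"
  have "profit g ?v ?s I = value_of ((!) zs ` I)" if "I \<in> Pow {..<length zs}" for I
  proof -
    have I: "I \<subseteq> {..<length zs}"
      using that by auto
    have inj: "inj_on ((!) zs) I"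
      using I \<open>distinct zs\<close> by (intro inj_on_nth) auto
    have "sum ?v I = sum v ((!) zs ` I)" "(\<lambda>j. \<Sum>i\<in>I. ?s i j) = (\<lambda>j. \<Sum>e\<in>(!) zs ` I. s e j)"
      using I inj by (auto simp: sum.reindex fun_eq_iff intro!: sum.cong)
    then show ?thesis
      by (simp add: profit_def)
  qed
  then have "profit g ?v ?s ` Pow {..<length zs} = value_of ` ((`) ((!) zs) ` Pow {..<length zs})"
    by (auto simp: image_image)
  also have "(`) ((!) zs) ` Pow {..<length zs} = Pow (set zs)"
    by (subst image_Pow_surj[OF refl]) (auto simp: set_conv_nth)
  finally show ?thesis
    by (simp add: sample_opt_def opt_def)
qed

lemma sample_opt_ge:
  assumes "distinct zs" "A \<subseteq> set zs"
  shows "value_of A \<le> sample_opt (map item zs)"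
  unfolding sample_opt_eq[OF assms(1)] using assms(2) by (intro Max_ge) auto

lemma sample_opt_le:
  assumes "distinct zs" "set zs \<subseteq> {..<n}"
  shows "sample_opt (map item zs) \<le> opt g n v s"
  unfolding sample_opt_eq[OF assms(1)] opt_def using assms(2) by (intro Max_mono) auto

lemma threshold_item: "threshold (map item zs) = Max (insert 0 ((\<lambda>e. value_of {e}) ` set zs))"
  by (simp add: threshold_def image_image profit_singleton)

lemma exceeds_item:
  "exceeds weak c (item e) \<longleftrightarrow> c < value_of {e} \<or> weak \<and> c = value_of {e}"
  by (simp add: exceeds_def profit_singleton)

lemma selected_secretary_nonneg:
  "0 \<le> value_of (selected (first_good (exceeds weak (threshold (map item zs)))) item ys)"
proof -
  have "0 \<le> threshold (map item zs)"
    by (simp add: threshold_item)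
  then show ?thesis
    using selected_first_good[of ys "exceeds weak (threshold (map item zs))" item]
    by (auto simp: exceeds_item)
qed

text \<open>The item \<open>x\<close> plays the best item and \<open>x'\<close> the second best one.\<close>

lemma selected_secretary_best:
  assumes M: "\<And>e. e < n \<Longrightarrow> value_of {e} \<le> value_of {x}" "0 < value_of {x}"
    and second: "\<And>e. e < n \<Longrightarrow> e \<noteq> x \<Longrightarrow> value_of {e} \<le> value_of {x'}"
    and x: "x \<in> set ys" and x': "x' \<in> set zs"
    and sub: "set ys \<subseteq> {..<n}" "set zs \<subseteq> {..<n} - {x}"
  shows "\<exists>weak. value_of {x} \<le>
    value_of (selected (first_good (exceeds weak (threshold (map item zs)))) item ys)"
proof
  \<comment> \<open>In a tie, whatever passes the weak rule is as good as \<open>x\<close>; without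
    one, only \<open>x\<close> passes the strict rule.\<close>
  define weak where "weak \<longleftrightarrow> value_of {x'} = value_of {x}"
  define c where "c = threshold (map item zs)"
  have c: "c = max 0 (value_of {x'})"
    unfolding c_def threshold_item
  proof (rule Max_eqI)
    show "max 0 (value_of {x'}) \<in> insert 0 ((\<lambda>e. value_of {e}) ` set zs)"
      using x' by (simp add: max_def)
    show "y \<le> max 0 (value_of {x'})" if "y \<in> insert 0 ((\<lambda>e. value_of {e}) ` set zs)" for y
      using that sub(2) second by (auto intro: max.coboundedI2)
  qed simp
  have x'_le: "value_of {x'} \<le> value_of {x}"
    using M(1) sub(2) x' by auto
  have ex: "exceeds weak c (item x)"
    using c x'_le M(2) by (auto simp: exceeds_item weak_def)
  have best: "value_of {x} \<le> value_of {e}" if "e \<in> set ys" "exceeds weak c (item e)" for e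
  proof (cases "e = x")
    case False
    with second that sub(1) have "value_of {e} \<le> value_of {x'}" by auto
    with that(2) c show ?thesis
      by (auto simp: exceeds_item weak_def max_def split: if_splits)
  qed simp
  show "value_of {x} \<le> value_of (selected (first_good (exceeds weak (threshold (map item zs)))) item ys)"
    using selected_first_good[of ys "exceeds weak c" item] ex x best unfolding c_def by auto
qed

end

subsection \<open>Random arrival order\<close>

lemma sum_permutations_map:
  assumes \<pi>: "\<pi> permutes {..<n}"
  shows "(\<Sum>\<sigma>\<in>permutations_of_set {..<n}. F (map \<pi> \<sigma>)) = sum F (permutations_of_set {..<n})"
proof -
  have "map \<pi> ` permutations_of_set {..<n} = permutations_of_set {..<n}"
    using permutes_inj_on[OF \<pi>] permutes_image[OF \<pi>] by (metis permutations_of_set_image_inj)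
  moreover have "inj_on (map \<pi>) (permutations_of_set {..<n})"
    using permutes_inj[OF \<pi>] by (simp add: inj_on_subset[OF inj_mapI])
  ultimately show ?thesis
    by (metis (no_types, lifting) comp_apply sum.cong sum.reindex)
qed

abbreviation orders :: "nat \<Rightarrow> nat list set" where
  "orders n \<equiv> permutations_of_set {..<n}"

definition sampled :: "nat \<Rightarrow> nat list \<Rightarrow> nat \<Rightarrow> real" where
  "sampled k \<sigma> e = of_bool (e \<in> set (take k \<sigma>))"

lemma sampled_map: "\<pi> permutes {..<n} \<Longrightarrow> sampled k (map \<pi> \<sigma>) (\<pi> e) = sampled k \<sigma> e"
  using permutes_inj[of \<pi> "{..<n}"] by (auto simp: sampled_def take_map inj_eq)

section \<open>Counting orders by the items they sample\<close>

context
  fixes n k :: nat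
  assumes k: "k \<le> n"
begin

lemma sum_sampled:
  assumes "\<sigma> \<in> orders n"
  shows "(\<Sum>e<n. sampled k \<sigma> e) = real k"
proof -
  have d: "distinct \<sigma>" "set \<sigma> = {..<n}" "length \<sigma> = n"
    using assms by (auto simp: permutations_of_set_def distinct_card[symmetric])
  have "(\<Sum>e<n. sampled k \<sigma> e) = real (card ({..<n} \<inter> set (take k \<sigma>)))"
    by (simp add: sampled_def Int_def)
  also have "{..<n} \<inter> set (take k \<sigma>) = set (take k \<sigma>)"
    using d(2) set_take_subset[of k \<sigma>] by auto
  also have "card \<dots> = k"
    using d k by (subst distinct_card) auto
  finally show ?thesis .
qed

text \<open>By symmetry every item is sampled in equally many orders, and each order samples exactly
  \<open>k\<close> items.\<close>

lemma sum_orders_sampled: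
  assumes e: "e < n"
  shows "real n * (\<Sum>\<sigma>\<in>orders n. sampled k \<sigma> e) = real k * real (card (orders n))"
proof -
  have eq: "(\<Sum>\<sigma>\<in>orders n. sampled k \<sigma> e') = (\<Sum>\<sigma>\<in>orders n. sampled k \<sigma> e)" if e': "e' < n" for e'
  proof -
    have \<pi>: "Transposition.transpose e e' permutes {..<n}"
      using e e' by (intro permutes_swap_id) auto
    have "(\<Sum>\<sigma>\<in>orders n. sampled k \<sigma> e') = (\<Sum>\<sigma>\<in>orders n. sampled k (map (Transposition.transpose e e') \<sigma>) e')"
      by (rule sum_permutations_map[OF \<pi>, symmetric])
    also have "\<dots> = (\<Sum>\<sigma>\<in>orders n. sampled k \<sigma> e)"
      using sampled_map[OF \<pi>, where e = e] by simp
    finally show ?thesis .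
  qed
  have "real n * (\<Sum>\<sigma>\<in>orders n. sampled k \<sigma> e) = (\<Sum>e'<n. \<Sum>\<sigma>\<in>orders n. sampled k \<sigma> e')"
    using eq by simp
  also have "\<dots> = (\<Sum>\<sigma>\<in>orders n. \<Sum>e'<n. sampled k \<sigma> e')"
    by (rule sum.swap)
  also have "\<dots> = real k * real (card (orders n))"
    by (simp add: sum_sampled)
  finally show ?thesis .
qed

lemma sum_orders_sampled_pair:
  assumes e: "e < n" "f < n" "e \<noteq> f"
  shows "real n * (real n - 1) * (\<Sum>\<sigma>\<in>orders n. sampled k \<sigma> e * sampled k \<sigma> f)
    = real k * (real k - 1) * real (card (orders n))"
proof -
  let ?P = "SIGMA a:{..<n}. {..<n} - {a}"
  have eq: "(\<Sum>\<sigma>\<in>orders n. sampled k \<sigma> a * sampled k \<sigma> b) = (\<Sum>\<sigma>\<in>orders n. sampled k \<sigma> e * sampled k \<sigma> f)"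
    if ab: "a < n" "b < n" "a \<noteq> b" for a b
  proof -
    \<comment> \<open>After swapping \<open>e\<close> with \<open>a\<close>, the item
      \<open>f\<close> sits at \<open>c\<close>; swapping \<open>c\<close> with \<open>b\<close>
      then leaves \<open>a\<close> alone, as \<open>c\<close> and \<open>b\<close> differ from
      \<open>a\<close>.\<close>
    define c where "c = Transposition.transpose e a f"
    define \<pi> where "\<pi> = Transposition.transpose c b \<circ> Transposition.transpose e a"
    have "c < n" "c \<noteq> a"
      using e ab by (auto simp: c_def Transposition.transpose_def)
    then have \<pi>: "\<pi> permutes {..<n}" "\<pi> e = a" "\<pi> f = b"
      unfolding \<pi>_def using e ab
      by (auto intro!: permutes_compose permutes_swap_id simp flip: c_def)
    have "(\<Sum>\<sigma>\<in>orders n. sampled k \<sigma> a * sampled k \<sigma> b) = (\<Sum>\<sigma>\<in>orders n. sampled k (map \<pi> \<sigma>) a * sampled k (map \<pi> \<sigma>) b)"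
      by (rule sum_permutations_map[OF \<pi>(1), symmetric])
    also have "\<dots> = (\<Sum>\<sigma>\<in>orders n. sampled k \<sigma> e * sampled k \<sigma> f)"
      using sampled_map[OF \<pi>(1), where e = e] sampled_map[OF \<pi>(1), where e = f] by (simp add: \<pi>)
    finally show ?thesis .
  qed
  have n: "1 \<le> n"
    using e by simp
  have "card ?P = n * (n - 1)"
    by (simp add: card_SigmaI)
  then have "real n * (real n - 1) * (\<Sum>\<sigma>\<in>orders n. sampled k \<sigma> e * sampled k \<sigma> f)
      = (\<Sum>p\<in>?P. \<Sum>\<sigma>\<in>orders n. sampled k \<sigma> e * sampled k \<sigma> f)"
    using n by (simp add: of_nat_diff)
  also have "\<dots> = (\<Sum>p\<in>?P. \<Sum>\<sigma>\<in>orders n. sampled k \<sigma> (fst p) * sampled k \<sigma> (snd p))"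
    by (rule sum.cong) (auto intro!: eq[symmetric])
  also have "\<dots> = (\<Sum>\<sigma>\<in>orders n. \<Sum>p\<in>?P. sampled k \<sigma> (fst p) * sampled k \<sigma> (snd p))"
    by (rule sum.swap)
  also have "\<dots> = (\<Sum>\<sigma>\<in>orders n. real k * (real k - 1))"
  proof (intro sum.cong refl)
    fix \<sigma> assume \<sigma>: "\<sigma> \<in> orders n"
    have "(\<Sum>p\<in>?P. sampled k \<sigma> (fst p) * sampled k \<sigma> (snd p)) = (\<Sum>a<n. \<Sum>b\<in>{..<n} - {a}. sampled k \<sigma> a * sampled k \<sigma> b)"
      by (simp add: sum.Sigma case_prod_beta)
    also have "\<dots> = (\<Sum>a<n. sampled k \<sigma> a * (real k - sampled k \<sigma> a))"
      by (intro sum.cong refl)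
        (simp add: sum_distrib_left[symmetric] sum_diff1 sum_sampled[OF \<sigma>])
    \<comment> \<open>Uses that \<open>sampled\<close> takes only the values 0 and 1, hence equals
      its square.\<close>
    also have "\<dots> = (\<Sum>a<n. sampled k \<sigma> a * (real k - 1))"
      by (intro sum.cong refl) (simp add: sampled_def)
    finally show "(\<Sum>p\<in>?P. sampled k \<sigma> (fst p) * sampled k \<sigma> (snd p)) = real k * (real k - 1)"
      by (simp add: sum_distrib_right[symmetric] sum_sampled[OF \<sigma>])
  qed
  finally show ?thesis by simp
qed

text \<open>For the secretary rules: \<open>e\<close> will be the second best item and
  \<open>f\<close> the best.\<close>

lemma sum_orders_separated:
  assumes e: "e < n" "f < n" "e \<noteq> f"
  shows "(\<Sum>\<sigma>\<in>orders n. sampled k \<sigma> e * (1 - sampled k \<sigma> f))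
    = real k * real (n - k) / (real n * (real n - 1)) * real (card (orders n))"
proof -
  have n: "real n * (real n - 1) \<noteq> 0" "real n \<noteq> 0"
    using e by auto
  have "real n * (real n - 1) * (\<Sum>\<sigma>\<in>orders n. sampled k \<sigma> e * (1 - sampled k \<sigma> f))
      = (real n - 1) * (real n * (\<Sum>\<sigma>\<in>orders n. sampled k \<sigma> e))
        - real n * (real n - 1) * (\<Sum>\<sigma>\<in>orders n. sampled k \<sigma> e * sampled k \<sigma> f)"
    by (simp add: algebra_simps sum_subtractf sum_distrib_left)
  also have "\<dots> = real k * real (n - k) * real (card (orders n))"
    unfolding sum_orders_sampled[OF e(1)] sum_orders_sampled_pair[OF e]
    using k by (simp add: of_nat_diff algebra_simps)
  finally show ?thesis
    using n by (simp add: field_simps)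
qed

text \<open>Distinct items are negatively correlated, so only the diagonal contributes to the variance.\<close>

lemma sum_orders_variance:
  assumes X: "X \<subseteq> {..<n}" and w: "\<And>e. e \<in> X \<Longrightarrow> 0 \<le> w e \<and> w e \<le> M" and n: "0 < n"
  shows "(\<Sum>\<sigma>\<in>orders n. ((\<Sum>e\<in>X. w e * sampled k \<sigma> e) - real k / real n * sum w X)\<^sup>2)
    \<le> real k / real n * M * sum w X * real (card (orders n))"
proof -
  define a where "a = real k / real n"
  define N where "N = real (card (orders n))"
  have fin: "finite X"
    using X by (meson finite_lessThan finite_subset)
  have a: "0 \<le> a" "a \<le> 1"
    using k n by (auto simp: a_def)
  have N: "0 \<le> N" by (simp add: N_def)
  have m1: "(\<Sum>\<sigma>\<in>orders n. sampled k \<sigma> e) = a * N" if "e \<in> X" for e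
    using sum_orders_sampled[of e] X that n by (auto simp: a_def N_def field_simps)
  have m2: "(\<Sum>\<sigma>\<in>orders n. sampled k \<sigma> e * sampled k \<sigma> f) \<le> a\<^sup>2 * N" if ef: "e \<in> X" "f \<in> X" "e \<noteq> f" for e f
  proof -
    have efn: "e < n" "f < n"
      using X ef by auto
    then have n2: "2 \<le> n" using ef(3) by linarith
    have "(\<Sum>\<sigma>\<in>orders n. sampled k \<sigma> e * sampled k \<sigma> f) = real k * (real k - 1) / (real n * (real n - 1)) * N"
      using sum_orders_sampled_pair[OF efn ef(3)] n2 by (simp add: N_def field_simps)
    also have "real k * (real k - 1) / (real n * (real n - 1)) = a * ((real k - 1) / (real n - 1))"
      by (simp add: a_def)
    also have "\<dots> \<le> a * a"
    proof (intro mult_left_mono a)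
      show "(real k - 1) / (real n - 1) \<le> a"
        using n2 k by (simp add: a_def field_simps)
    qed
    finally show ?thesis
      using N by (simp add: mult_right_mono power2_eq_square)
  qed
  have pair: "(\<Sum>\<sigma>\<in>orders n. (sampled k \<sigma> e - a) * (sampled k \<sigma> f - a)) \<le> (if e = f then a * N else 0)"
    if ef: "e \<in> X" "f \<in> X" for e f
  proof -
    have "(\<Sum>\<sigma>\<in>orders n. (sampled k \<sigma> e - a) * (sampled k \<sigma> f - a)) =
        (\<Sum>\<sigma>\<in>orders n. sampled k \<sigma> e * sampled k \<sigma> f - a * sampled k \<sigma> e - a * sampled k \<sigma> f + a\<^sup>2)"
      by (simp add: algebra_simps power2_eq_square)
    also have "\<dots> = (\<Sum>\<sigma>\<in>orders n. sampled k \<sigma> e * sampled k \<sigma> f) - a * (a * N) - a * (a * N) + a\<^sup>2 * N"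
      using m1[OF ef(1)] m1[OF ef(2)]
      by (simp add: sum.distrib sum_subtractf sum_distrib_left[symmetric] N_def)
    finally have *: "(\<Sum>\<sigma>\<in>orders n. (sampled k \<sigma> e - a) * (sampled k \<sigma> f - a)) =
        (\<Sum>\<sigma>\<in>orders n. sampled k \<sigma> e * sampled k \<sigma> f) - a\<^sup>2 * N"
      by (simp add: power2_eq_square algebra_simps)
    show ?thesis
    proof (cases "e = f")
      case True
      have "(\<Sum>\<sigma>\<in>orders n. sampled k \<sigma> e * sampled k \<sigma> e) = a * N"
        unfolding m1[OF ef(1), symmetric] by (intro sum.cong) (auto simp: sampled_def)
      with * True N show ?thesis by simp
    next
      case False
      with * m2[OF ef] show ?thesis by simp
    qed
  qed
  have "(\<Sum>\<sigma>\<in>orders n. ((\<Sum>e\<in>X. w e * sampled k \<sigma> e) - a * sum w X)\<^sup>2)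
      = (\<Sum>\<sigma>\<in>orders n. (\<Sum>e\<in>X. w e * (sampled k \<sigma> e - a))\<^sup>2)"
    by (simp add: right_diff_distrib sum_subtractf sum_distrib_left mult.commute)
  also have "\<dots> = (\<Sum>\<sigma>\<in>orders n. \<Sum>e\<in>X. \<Sum>f\<in>X. w e * w f * ((sampled k \<sigma> e - a) * (sampled k \<sigma> f - a)))"
    by (simp add: power2_eq_square sum_product mult.assoc mult.left_commute)
  also have "\<dots> = (\<Sum>e\<in>X. \<Sum>f\<in>X. \<Sum>\<sigma>\<in>orders n. w e * w f * ((sampled k \<sigma> e - a) * (sampled k \<sigma> f - a)))"
    by (subst sum.swap, rule sum.cong, rule refl, rule sum.swap)
  also have "\<dots> = (\<Sum>e\<in>X. \<Sum>f\<in>X. w e * w f * (\<Sum>\<sigma>\<in>orders n. (sampled k \<sigma> e - a) * (sampled k \<sigma> f - a)))"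
    by (simp add: sum_distrib_left)
  also have "\<dots> \<le> (\<Sum>e\<in>X. \<Sum>f\<in>X. w e * w f * (if e = f then a * N else 0))"
    using w pair by (intro sum_mono mult_left_mono) auto
  also have "\<dots> = (\<Sum>e\<in>X. w e * w e * (a * N))"
    using fin by (simp add: if_distrib[of "\<lambda>x. _ * x"] cong: if_cong)
  also have "\<dots> \<le> (\<Sum>e\<in>X. M * w e * (a * N))"
    using w a N by (intro sum_mono mult_right_mono) auto
  also have "\<dots> = a * M * sum w X * N"
    by (simp add: sum_distrib_left sum_distrib_right algebra_simps)
  finally show ?thesis
    by (simp add: a_def N_def)
qed

end

subsection \<open>The competitive ratio\<close>

lemma orders_props:
  assumes "\<sigma> \<in> orders n"
  shows "distinct \<sigma>" "set \<sigma> = {..<n}" "length \<sigma> = n"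
    "set (drop k \<sigma>) = {..<n} - set (take k \<sigma>)"
proof -
  show d: "distinct \<sigma>" "set \<sigma> = {..<n}"
    using assms by (auto simp: permutations_of_set_def)
  then show "length \<sigma> = n"
    by (metis card_lessThan distinct_card)
  have "set (take k \<sigma>) \<union> set (drop k \<sigma>) = {..<n}" "set (take k \<sigma>) \<inter> set (drop k \<sigma>) = {}"
    using d by (metis append_take_drop_id set_append, metis append_take_drop_id distinct_append)
  then show "set (drop k \<sigma>) = {..<n} - set (take k \<sigma>)"
    by auto
qed

context cost_instance
begin

abbreviation optimum :: real where
  "optimum \<equiv> opt g n v s"

lemma optimum_attained:
  obtains Opt where "Opt \<subseteq> {..<n}" "value_of Opt = optimum"
proof -
  have "optimum \<in> value_of ` Pow {..<n}"
    unfolding opt_def by (intro Max_in) auto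
  then show ?thesis
    using that by auto
qed

text \<open>By submodularity the gain is least at \<open>Opt - {e}\<close>, where optimality makes
  it nonnegative.\<close>

lemma marginal_in_optimum:
  assumes Opt: "Opt \<subseteq> {..<n}" "value_of Opt = optimum" and A: "A \<subseteq> Opt" "e \<in> Opt"
  shows "value_of A \<le> value_of (insert e A)"
proof (cases "e \<in> A")
  case False
  have "value_of (insert e (Opt - {e})) - value_of (Opt - {e}) \<le> value_of (insert e A) - value_of A"
    using Opt A False by (intro marginal_antimono) auto
  moreover have "insert e (Opt - {e}) = Opt"
    using A by auto
  moreover have "value_of (Opt - {e}) \<le> optimum"
    using Opt(1) unfolding opt_def by (intro Max_ge) auto
  ultimately show ?thesis
    using Opt(2) by simp
qed (simp add: insert_absorb)

section \<open>Expected profit of the individual strategies\<close>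

lemma accepted_greedy:
  assumes \<sigma>: "\<sigma> \<in> orders n" and k: "k \<le> n"
  shows "accepted (greedy_alg k) v s \<sigma> =
    selected (greedy (sample_opt (map item (take k \<sigma>)) / (8 * real d))) item (drop k \<sigma>)"
  unfolding greedy_alg_def using orders_props(3)[OF \<sigma>] k by (subst accepted_two_phase) auto

lemma accepted_secretary:
  assumes \<sigma>: "\<sigma> \<in> orders n" and k: "k \<le> n"
  shows "accepted (secretary_alg weak k) v s \<sigma> =
    selected (first_good (exceeds weak (threshold (map item (take k \<sigma>))))) item (drop k \<sigma>)"
  unfolding secretary_alg_def using orders_props(3)[OF \<sigma>] k by (subst accepted_two_phase) auto

lemma secretary_nonneg:
  "\<sigma> \<in> orders n \<Longrightarrow> k \<le> n \<Longrightarrow> 0 \<le> value_of (accepted (secretary_alg weak k) v s \<sigma>)"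
  by (simp add: accepted_secretary selected_secretary_nonneg)

lemma greedy_nonneg:
  assumes \<sigma>: "\<sigma> \<in> orders n" and k: "k \<le> n"
  shows "0 \<le> value_of (accepted (greedy_alg k) v s \<sigma>)"
  unfolding accepted_greedy[OF assms]
  using orders_props[OF \<sigma>] by (intro selected_greedy_nonneg) auto

text \<open>Here \<open>\<tau>\<close> lies between \<open>opt / (32 * d)\<close> and
  \<open>opt / (8 * d)\<close>. A full load earns \<open>\<tau> - M\<close>, at least
  \<open>3 / 4 * \<tau>\<close>; otherwise duality takes at most \<open>opt / 8 + opt / 64\<close>
  from the \<open>opt / 4\<close> of the second phase.\<close>

lemma greedy_on_balanced_order:
  assumes d: "1 \<le> d" and \<sigma>: "\<sigma> \<in> orders n" and k: "k \<le> n"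
    and Opt: "Opt \<subseteq> {..<n}" "value_of Opt = optimum" and pos: "0 < optimum"
    and M: "\<And>e. e < n \<Longrightarrow> value_of {e} \<le> M" "0 \<le> M" "M \<le> optimum / (128 * real d)"
    and half1: "optimum / 4 \<le> value_of (Opt \<inter> set (take k \<sigma>))"
    and half2: "optimum / 4 \<le> value_of (Opt \<inter> set (drop k \<sigma>))"
  shows "3 * optimum / (128 * real d) \<le> value_of (accepted (greedy_alg k) v s \<sigma>)"
proof -
  define \<tau> where "\<tau> = sample_opt (map item (take k \<sigma>)) / (8 * real d)"
  define B where "B = selected (greedy \<tau>) item (drop k \<sigma>)"
  note props = orders_props[OF \<sigma>]
  have ys: "distinct (drop k \<sigma>)" "set (drop k \<sigma>) \<subseteq> {..<n}"
    and zs: "distinct (take k \<sigma>)" "set (take k \<sigma>) \<subseteq> {..<n}"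
    using props by (auto dest: in_set_takeD)
  have "optimum / 4 \<le> sample_opt (map item (take k \<sigma>))"
    using half1 sample_opt_ge[OF zs(1), of "Opt \<inter> set (take k \<sigma>)"] by simp
  then have \<tau>_ge: "optimum / (32 * real d) \<le> \<tau>"
    using d by (simp add: \<tau>_def field_simps)
  have \<tau>_le: "real d * \<tau> \<le> optimum / 8"
    using sample_opt_le[OF zs] d by (simp add: \<tau>_def field_simps)
  have M4: "M \<le> \<tau> / 4"
    using M(3) \<tau>_ge by simp
  have "0 < optimum / (32 * real d)"
    using pos d by simp
  then have \<tau>0: "0 < \<tau>"
    using \<tau>_ge by linarith
  have "\<tau> - M \<le> value_of B \<or>
      value_of (Opt \<inter> set (drop k \<sigma>)) \<le> value_of B + real d * \<tau> + 2 * real d * M"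
    unfolding B_def
  proof (rule maximal_saturated_profit[OF Opt(1) _ M(1,2) _ \<tau>0 ys(2)
        selected_greedy(1)[OF ys] selected_greedy(2)[OF ys] selected_greedy(3)[OF ys]
        selected_greedy(4)[OF ys]])
    show "2 * M \<le> \<tau>" using M4 \<tau>0 by simp
  qed (use marginal_in_optimum[OF Opt] in auto)
  then have "3 * optimum / (128 * real d) \<le> value_of B"
  proof
    assume "\<tau> - M \<le> value_of B"
    then have "3 / 4 * \<tau> \<le> value_of B"
      using M4 by simp
    moreover have "3 * optimum / (128 * real d) = 3 / 4 * (optimum / (32 * real d))"
      by simp
    ultimately show ?thesis
      using \<tau>_ge by linarith
  next
    assume *: "value_of (Opt \<inter> set (drop k \<sigma>)) \<le> value_of B + real d * \<tau> + 2 * real d * M"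
    have "2 * real d * M \<le> optimum / 64"
      using M(3) d by (simp add: field_simps)
    with * half2 \<tau>_le have "3 * optimum / 128 \<le> value_of B"
      using pos by simp
    moreover have "3 * optimum / (128 * real d) \<le> 3 * optimum / 128"
      using d pos by (intro divide_left_mono) auto
    ultimately show ?thesis by linarith
  qed
  then show ?thesis
    unfolding accepted_greedy[OF \<sigma> k] B_def \<tau>_def .
qed

text \<open>
  The marginal values of an optimal set in a fixed order turn its profit into an additive
  function that bounds the profit of all its subsets from below.
\<close>

lemma greedy_expectation:
  assumes d: "1 \<le> d" and pos: "0 < optimum"
    and M: "\<And>e. e < n \<Longrightarrow> value_of {e} \<le> M" "0 \<le> M" "M \<le> optimum / (128 * real d)"
  shows "9 * optimum / (512 * real d) * real (card (orders n))
    \<le> (\<Sum>\<sigma>\<in>orders n. value_of (accepted (greedy_alg (n div 2)) v s \<sigma>))"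
proof -
  define k where "k = n div 2"
  obtain Opt where Opt: "Opt \<subseteq> {..<n}" "value_of Opt = optimum"
    using optimum_attained .
  define w where "w e = value_of (Opt \<inter> {..e}) - value_of (Opt \<inter> {..<e})" for e
  define X where "X \<sigma> = (\<Sum>e\<in>Opt. w e * sampled k \<sigma> e)" for \<sigma>
  define N where "N = real (card (orders n))"
  define a where "a = real k / real n"
  have fin: "finite Opt"
    using Opt(1) by (meson finite_lessThan finite_subset)
  have k: "k \<le> n"
    by (simp add: k_def)
  have init: "A \<inter> {..e} = insert e (A \<inter> {..<e})" if "e \<in> A" for e and A :: "nat set"
    using that by auto
  have w: "0 \<le> w e \<and> w e \<le> M" if e: "e \<in> Opt" for e
  proof
    show "0 \<le> w e"
      unfolding w_def init[OF e] using marginal_in_optimum[OF Opt _ e, of "Opt \<inter> {..<e}"] by simp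
    have "value_of (insert e (Opt \<inter> {..<e})) - value_of (Opt \<inter> {..<e})
        \<le> value_of (insert e {}) - value_of {}"
      using e Opt(1) by (intro marginal_antimono) auto
    then show "w e \<le> M"
      unfolding w_def init[OF e] using M(1)[of e] e Opt(1) by auto
  qed
  have sum_w: "sum w Opt = optimum"
    using profit_telescope[OF Opt(1)] Opt(2) by (simp add: w_def)
  \<comment> \<open>Intersecting with \<open>Y\<close> leaves fewer earlier items, so by
    submodularity each marginal value can only grow.\<close>
  have lower: "sum w (Opt \<inter> Y) \<le> value_of (Opt \<inter> Y)" for Y
  proof -
    have "w e \<le> value_of (Opt \<inter> Y \<inter> {..e}) - value_of (Opt \<inter> Y \<inter> {..<e})" if e: "e \<in> Opt \<inter> Y" for e
    proof -
      have "value_of (insert e (Opt \<inter> {..<e})) - value_of (Opt \<inter> {..<e})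
          \<le> value_of (insert e (Opt \<inter> Y \<inter> {..<e})) - value_of (Opt \<inter> Y \<inter> {..<e})"
        using e Opt(1) by (intro marginal_antimono) auto
      then show ?thesis
        unfolding w_def using init[of e Opt] init[OF e] e by simp
    qed
    then have "sum w (Opt \<inter> Y) \<le>
        (\<Sum>e\<in>Opt \<inter> Y. value_of (Opt \<inter> Y \<inter> {..e}) - value_of (Opt \<inter> Y \<inter> {..<e}))"
      by (rule sum_mono)
    also have "\<dots> = value_of (Opt \<inter> Y)"
      using Opt(1) by (intro profit_telescope[symmetric]) auto
    finally show ?thesis .
  qed
  have "optimum / (128 * real d) \<le> optimum / 128"
    using d pos by (intro divide_left_mono) auto
  with M(3) have M128: "M \<le> optimum / 128" by linarith
  \<comment> \<open>Many items are forced by their small values; four suffice for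
    \<open>n div 2\<close> to be at least \<open>3 / 8\<close> of \<open>n\<close>.\<close>
  have n4: "4 \<le> n"
  proof -
    have "optimum \<le> (\<Sum>e\<in>Opt. M)"
      unfolding sum_w[symmetric] using w by (intro sum_mono) auto
    also have "\<dots> \<le> real n * M"
      using card_mono[OF finite_lessThan Opt(1)] M(2) by (auto intro: mult_right_mono)
    also have "\<dots> \<le> real n * (optimum / 128)"
      using M128 by (intro mult_left_mono) auto
    finally have "optimum * 1 \<le> optimum * (real n / 128)"
      by (simp add: mult.commute)
    then have "1 \<le> real n / 128"
      using pos by (subst (asm) mult_le_cancel_left_pos) auto
    then show ?thesis by linarith
  qed
  have a: "3 / 8 \<le> a" "a \<le> 1 / 2"
  proof -
    have "n \<le> 2 * k + 1" "2 * k \<le> n"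
      by (auto simp: k_def)
    then have "real n \<le> 2 * real k + 1" "2 * real k \<le> real n"
      by linarith+
    with n4 show "3 / 8 \<le> a" "a \<le> 1 / 2"
      by (auto simp: a_def field_simps)
  qed
  \<comment> \<open>Outside \<open>bad\<close>, the sampled weight lies between
    \<open>3 / 8 - 1 / 8\<close> and \<open>1 / 2 + 1 / 8\<close> of the optimum, leaving each phase
    a quarter. Chebyshev's inequality bounds \<open>bad\<close> by a quarter of all orders.\<close>
  define bad where "bad = {\<sigma> \<in> orders n. optimum / 8 \<le> \<bar>X \<sigma> - a * optimum\<bar>}"
  have fin_orders: "finite (orders n)"
    by simp
  have bad_sub: "bad \<subseteq> orders n"
    by (auto simp: bad_def)
  have "real (card bad) * (optimum / 8)\<^sup>2 \<le> (\<Sum>\<sigma>\<in>bad. (X \<sigma> - a * optimum)\<^sup>2)"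
  proof -
    have "(\<Sum>\<sigma>\<in>bad. (optimum / 8)\<^sup>2) \<le> (\<Sum>\<sigma>\<in>bad. (X \<sigma> - a * optimum)\<^sup>2)"
    proof (rule sum_mono)
      fix \<sigma> assume "\<sigma> \<in> bad"
      then have "\<bar>optimum / 8\<bar> \<le> \<bar>X \<sigma> - a * optimum\<bar>"
        using pos by (simp add: bad_def)
      then show "(optimum / 8)\<^sup>2 \<le> (X \<sigma> - a * optimum)\<^sup>2"
        by (simp only: abs_le_square_iff)
    qed
    then show ?thesis by simp
  qed
  also have "\<dots> \<le> (\<Sum>\<sigma>\<in>orders n. (X \<sigma> - a * optimum)\<^sup>2)"
    using bad_sub by (intro sum_mono2) auto
  also have "\<dots> \<le> a * M * optimum * N"
    using sum_orders_variance[where w = w and M = M, OF k Opt(1) w] n4 by (simp add: X_def a_def sum_w N_def)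
  also have "\<dots> \<le> 1 / 2 * (optimum / 128) * optimum * N"
    using a M(2) M128 pos by (intro mult_right_mono mult_mono) (auto simp: N_def)
  also have "\<dots> = N / 4 * (optimum / 8)\<^sup>2"
    by (simp add: power2_eq_square)
  finally have card_bad: "real (card bad) \<le> N / 4"
    using pos by (subst (asm) mult_le_cancel_right_pos) auto
  have good: "3 * optimum / (128 * real d) \<le> value_of (accepted (greedy_alg k) v s \<sigma>)"
    if \<sigma>: "\<sigma> \<in> orders n - bad" for \<sigma>
  proof -
    have so: "\<sigma> \<in> orders n" using \<sigma> by simp
    have X1: "X \<sigma> = sum w (Opt \<inter> set (take k \<sigma>))"
      using fin by (simp add: X_def sampled_def sum.inter_restrict of_bool_def if_distrib cong: if_cong)
    have "Opt \<inter> set (drop k \<sigma>) = Opt - set (take k \<sigma>)"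
      using orders_props(4)[OF so] Opt(1) by auto
    then have X2: "sum w (Opt \<inter> set (drop k \<sigma>)) = optimum - X \<sigma>"
      using sum.Int_Diff[OF fin, of w "set (take k \<sigma>)"] by (simp add: X1 sum_w)
    have dev: "\<bar>X \<sigma> - a * optimum\<bar> < optimum / 8"
      using \<sigma> by (auto simp: bad_def)
    moreover have "3 / 8 * optimum \<le> a * optimum" "a * optimum \<le> 1 / 2 * optimum"
      using a pos by (auto intro!: mult_right_mono)
    ultimately have "optimum / 4 \<le> X \<sigma>" "optimum / 4 \<le> optimum - X \<sigma>"
      by argo+
    then have half: "optimum / 4 \<le> value_of (Opt \<inter> set (take k \<sigma>))"
      "optimum / 4 \<le> value_of (Opt \<inter> set (drop k \<sigma>))"
      using lower[of "set (take k \<sigma>)"] lower[of "set (drop k \<sigma>)"] X1 X2 by linarith+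
    show ?thesis
      by (rule greedy_on_balanced_order[OF d so k Opt pos M half])
  qed
  have "3 / 4 * N \<le> real (card (orders n - bad))"
    using card_bad bad_sub card_mono[OF fin_orders bad_sub] finite_subset[OF bad_sub]
    by (simp add: card_Diff_subset of_nat_diff N_def)
  then have "3 / 4 * N * (3 * optimum / (128 * real d))
      \<le> real (card (orders n - bad)) * (3 * optimum / (128 * real d))"
    using pos by (intro mult_right_mono) auto
  also have "\<dots> \<le> (\<Sum>\<sigma>\<in>orders n - bad. value_of (accepted (greedy_alg k) v s \<sigma>))"
    using sum_mono[of "orders n - bad" "\<lambda>_. 3 * optimum / (128 * real d)", OF good] by simp
  also have "\<dots> \<le> (\<Sum>\<sigma>\<in>orders n. value_of (accepted (greedy_alg k) v s \<sigma>))"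
    using greedy_nonneg k by (intro sum_mono2) auto
  finally show ?thesis
    by (simp add: N_def k_def mult.commute)
qed

text \<open>A tie for the best profit cannot be foreseen, so both rules are summed: if the second
  best item is sampled and \<open>x\<close> is not, one of them succeeds, and neither ever
  loses.\<close>

lemma secretary_expectation:
  assumes x: "x < n" and best: "\<And>e. e < n \<Longrightarrow> value_of {e} \<le> value_of {x}" and pos: "0 < value_of {x}"
  shows "value_of {x} / 4 * real (card (orders n)) \<le>
    (\<Sum>\<sigma>\<in>orders n. value_of (accepted (secretary_alg False (n div 2)) v s \<sigma>)
      + value_of (accepted (secretary_alg True (n div 2)) v s \<sigma>))"
proof (cases "n = 1")
  case True
  \<comment> \<open>A single item means an empty sample and no second best item; the strict rule
    with threshold 0 takes it.\<close>
  have "value_of {x} / 4 \<le> value_of (accepted (secretary_alg False (n div 2)) v s \<sigma>)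
      + value_of (accepted (secretary_alg True (n div 2)) v s \<sigma>)" if \<sigma>: "\<sigma> \<in> orders n" for \<sigma>
  proof -
    have set\<sigma>: "set \<sigma> = {x}"
      using orders_props(2)[OF \<sigma>] True x by auto
    have "exceeds False (threshold []) (item x)"
      using pos threshold_item[of "[]"] by (simp add: exceeds_item)
    then have "accepted (secretary_alg False (n div 2)) v s \<sigma> = {x}"
      using selected_first_good[of \<sigma> "exceeds False (threshold [])" item] set\<sigma> True
        accepted_secretary[OF \<sigma>, of "n div 2" False] by auto
    then show ?thesis
      using secretary_nonneg[OF \<sigma>, of "n div 2" True] pos by simp
  qed
  from sum_mono[of "orders n", OF this] show ?thesis by (simp add: mult.commute)
next
  case False
  define k where "k = n div 2"
  have n: "2 \<le> n" using False x by simp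
  have k: "k \<le> n" by (simp add: k_def)
  define f where "f e = value_of {e}" for e
  have ne: "f ` ({..<n} - {x}) \<noteq> {}"
  proof -
    have "(if x = 0 then 1 else 0) \<in> {..<n} - {x}"
      using n by auto
    then show ?thesis by blast
  qed
  then have "Max (f ` ({..<n} - {x})) \<in> f ` ({..<n} - {x})"
    by (intro Max_in) auto
  then obtain x' where "x' \<in> {..<n} - {x}" and x'_max: "f x' = Max (f ` ({..<n} - {x}))"
    by (metis imageE)
  then have x': "x' < n" "x' \<noteq> x" by auto
  have second: "value_of {e} \<le> value_of {x'}" if "e < n" "e \<noteq> x" for e
    using that x'_max unfolding f_def by (auto intro!: Max_ge)
  define S where "S weak \<sigma> = value_of (accepted (secretary_alg weak k) v s \<sigma>)" for weak \<sigma>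
  have each: "value_of {x} * (sampled k \<sigma> x' * (1 - sampled k \<sigma> x)) \<le> S False \<sigma> + S True \<sigma>"
    if \<sigma>: "\<sigma> \<in> orders n" for \<sigma>
  proof -
    have nonneg: "0 \<le> S weak \<sigma>" for weak
      unfolding S_def using secretary_nonneg[OF \<sigma> k] .
    show ?thesis
    proof (cases "x' \<in> set (take k \<sigma>) \<and> x \<notin> set (take k \<sigma>)")
      case True
      note props = orders_props[OF \<sigma>]
      have "\<exists>weak. value_of {x} \<le> S weak \<sigma>"
        unfolding S_def accepted_secretary[OF \<sigma> k]
        using True props(2,4) x set_take_subset[of k \<sigma>]
        by (intro selected_secretary_best[OF best pos second]) auto
      then obtain weak where "value_of {x} \<le> S weak \<sigma>" ..
      then have "value_of {x} \<le> S False \<sigma> + S True \<sigma>"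
        using nonneg[of False] nonneg[of True] by (cases weak) auto
      moreover have "sampled k \<sigma> x' = 1" "sampled k \<sigma> x = 0"
        using True by (simp_all add: sampled_def)
      ultimately show ?thesis by simp
    next
      case False
      then show ?thesis
        using nonneg[of False] nonneg[of True] by (auto simp: sampled_def)
    qed
  qed
  have quarter: "1 / 4 \<le> real k * real (n - k) / (real n * (real n - 1))"
  proof -
    have "real n * (real n - 1) \<le> 4 * (real k * real (n - k))"
    proof (cases "even n")
      case True
      then have "real n = 2 * real k" "real (n - k) = real k"
        by (auto simp: k_def of_nat_diff elim: evenE)
      then show ?thesis by (simp add: algebra_simps)
    next
      case False
      then have "real n = 2 * real k + 1" "real (n - k) = real k + 1"
        by (auto simp: k_def elim: oddE)
      then show ?thesis by (simp add: algebra_simps)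
    qed
    then show ?thesis
      using n by (simp add: field_simps)
  qed
  have "value_of {x} * (1 / 4 * real (card (orders n)))
      \<le> value_of {x} * (real k * real (n - k) / (real n * (real n - 1)) * real (card (orders n)))"
    by (rule mult_left_mono[OF mult_right_mono[OF quarter]]) (use pos in auto)
  also have "\<dots> = (\<Sum>\<sigma>\<in>orders n. value_of {x} * (sampled k \<sigma> x' * (1 - sampled k \<sigma> x)))"
    unfolding sum_orders_separated[OF k x'(1) x x'(2), symmetric] by (rule sum_distrib_left)
  also have "\<dots> \<le> (\<Sum>\<sigma>\<in>orders n. S False \<sigma> + S True \<sigma>)"
    by (rule sum_mono) (rule each)
  finally show ?thesis
    by (simp add: S_def k_def)
qed

text \<open>If \<open>M\<close> exceeds \<open>opt / (128 * d)\<close>, a quarter of it exceeds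
  \<open>opt / (512 * d)\<close>; otherwise greedy earns at least that much.\<close>

lemma total_profit_ge:
  assumes d: "1 \<le> d"
  shows "optimum / (512 * real d) * real (card (orders n)) \<le>
    (\<Sum>\<sigma>\<in>orders n. value_of (accepted (greedy_alg (n div 2)) v s \<sigma>)
      + (value_of (accepted (secretary_alg False (n div 2)) v s \<sigma>)
        + value_of (accepted (secretary_alg True (n div 2)) v s \<sigma>)))"
    (is "_ \<le> (\<Sum>\<sigma>\<in>_. ?G \<sigma> + ?S \<sigma>)")
proof -
  have G: "0 \<le> sum ?G (orders n)" and S: "0 \<le> sum ?S (orders n)"
    by (intro sum_nonneg greedy_nonneg add_nonneg_nonneg secretary_nonneg; simp)+
  define N where "N = real (card (orders n))"
  have N: "0 \<le> N" by (simp add: N_def)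
  define M where "M = Max (insert 0 ((\<lambda>e. value_of {e}) ` {..<n}))"
  have M: "value_of {e} \<le> M" if "e < n" for e
    unfolding M_def using that by (intro Max_ge) auto
  have M0: "0 \<le> M"
    unfolding M_def by (intro Max_ge) auto
  have "optimum / (512 * real d) * N \<le> sum ?G (orders n) + sum ?S (orders n)"
  proof (cases "optimum \<le> 0")
    case True
    then have "optimum / (512 * real d) * N \<le> 0"
      using N by (intro mult_nonpos_nonneg divide_nonpos_nonneg) auto
    with G S show ?thesis by linarith
  next
    case False
    then have pos: "0 < optimum" by simp
    show ?thesis
    proof (cases "M \<le> optimum / (128 * real d)")
      case True
      have "optimum / (512 * real d) * N \<le> 9 * optimum / (512 * real d) * N"
        using pos N by (intro mult_right_mono divide_right_mono) auto
      with greedy_expectation[OF d pos M M0 True] S show ?thesis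
        by (simp add: N_def)
    next
      case False
      have "0 < optimum / (128 * real d)"
        using pos d by simp
      with False have "0 < M" by linarith
      moreover have "M \<in> insert 0 ((\<lambda>e. value_of {e}) ` {..<n})"
        unfolding M_def by (intro Max_in) auto
      ultimately obtain x where x: "x < n" "value_of {x} = M" by auto
      have "optimum / (512 * real d) * N \<le> M / 4 * N"
        using False N by (intro mult_right_mono) auto
      also have "\<dots> \<le> sum ?S (orders n)"
        using secretary_expectation[OF x(1)] M x(2) \<open>0 < M\<close> by (simp add: N_def)
      finally show ?thesis
        using G by linarith
    qed
  qed
  then show ?thesis
    by (simp add: N_def sum.distrib)
qed

end

section \<open>Mixing the strategies\<close>

lemma pair_pmf_of_set:
  assumes "finite A" "A \<noteq> {}" "finite B" "B \<noteq> {}"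
  shows "pair_pmf (pmf_of_set A) (pmf_of_set B) = pmf_of_set (A \<times> B)"
proof (rule pmf_eqI)
  fix x
  show "pmf (pair_pmf (pmf_of_set A) (pmf_of_set B)) x = pmf (pmf_of_set (A \<times> B)) x"
    using assms by (cases x) (simp add: pmf_pair indicator_def card_cartesian_product)
qed

lemma expected_profit_uniform:
  fixes algs :: "nat \<Rightarrow> online_alg"
  assumes "0 < m"
  shows "expected_profit g n (map_pmf algs (pmf_of_set {..<m})) v s =
    (\<Sum>j<m. \<Sum>\<sigma>\<in>orders n. profit g v s (accepted (algs j) v s \<sigma>))
      / (real m * real (card (orders n)))"
proof -
  have orders: "finite (orders n)" "orders n \<noteq> {}"
    by (auto simp: permutations_of_set_empty_iff)
  have "pair_pmf (map_pmf algs (pmf_of_set {..<m})) (pmf_of_set (orders n)) =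
      map_pmf (apfst algs) (pmf_of_set ({..<m} \<times> orders n))"
    unfolding pair_map_pmf1 using assms orders by (subst pair_pmf_of_set) auto
  then have "expected_profit g n (map_pmf algs (pmf_of_set {..<m})) v s =
      measure_pmf.expectation (pmf_of_set ({..<m} \<times> orders n))
        (\<lambda>(j, \<sigma>). profit g v s (accepted (algs j) v s \<sigma>))"
    by (simp add: expected_profit_def case_prod_unfold)
  also have "\<dots> = (\<Sum>(j, \<sigma>)\<in>{..<m} \<times> orders n. profit g v s (accepted (algs j) v s \<sigma>))
      / real (card ({..<m} \<times> orders n))"
    using assms orders by (subst integral_pmf_of_set) auto
  finally show ?thesis
    by (simp add: sum.cartesian_product card_cartesian_product)
qed

theorem mainTheorem1:
  shows "\<exists>C::real. C > 0 \<and>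
    (\<forall>(d::nat) (g :: (nat \<Rightarrow> real) \<Rightarrow> real).
       d \<ge> 1 \<longrightarrow>
       (\<forall>x\<in>orthant d. 0 \<le> g x) \<longrightarrow>
       convex_cost d g \<longrightarrow>
       mono_on (orthant d) g \<longrightarrow>
       supermodular d g \<longrightarrow>
       regular_cost d g \<longrightarrow>
       (\<forall>n. \<exists>R. competitive d g n R (C * real d)))"
proof (intro exI[of _ 1536] conjI allI impI)
  fix d n :: nat and g :: "(nat \<Rightarrow> real) \<Rightarrow> real"
  assume d: "1 \<le> d" and nonneg: "\<forall>x\<in>orthant d. 0 \<le> g x" and "convex_cost d g" "supermodular d g"
    and reg: "regular_cost d g"
  then interpret supermodular_cost d g
    by unfold_locales
      (auto simp: regular_cost_def zero_fun_def intro: continuous_on_differentiable_cost)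
  \<comment> \<open>Index 1 is the strict secretary rule, index 2 the weak one. A uniform choice
    among three strategies keeps a third of their total, whence
    \<open>1536 = 3 * 512\<close>.\<close>
  define algs where "algs j = (if j = 0 then greedy_alg (n div 2) else secretary_alg (j = 2) (n div 2))"
    for j :: nat
  have "opt g n v s / (1536 * real d) \<le> expected_profit g n (map_pmf algs (pmf_of_set {..<3})) v s"
    if "valid_instance d n v s" for v s
  proof -
    interpret cost_instance d g n v s
      using that by unfold_locales
    define N where "N = real (card (orders n))"
    have N: "0 < N"
      by (simp add: N_def)
    have "(\<Sum>j<3. \<Sum>\<sigma>\<in>orders n. value_of (accepted (algs j) v s \<sigma>)) =
      (\<Sum>\<sigma>\<in>orders n. value_of (accepted (greedy_alg (n div 2)) v s \<sigma>)
        + (value_of (accepted (secretary_alg False (n div 2)) v s \<sigma>)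
          + value_of (accepted (secretary_alg True (n div 2)) v s \<sigma>)))"
      by (simp add: algs_def sum.distrib eval_nat_numeral)
    with total_profit_ge[OF d] have "optimum / (512 * real d) * N \<le>
        (\<Sum>j<3. \<Sum>\<sigma>\<in>orders n. value_of (accepted (algs j) v s \<sigma>))"
      by (simp only: N_def)
    then have "optimum / (512 * real d) * N / (3 * N) \<le>
        (\<Sum>j<3. \<Sum>\<sigma>\<in>orders n. value_of (accepted (algs j) v s \<sigma>)) / (3 * N)"
      using N by (intro divide_right_mono) auto
    then show ?thesis
      using N by (simp add: expected_profit_uniform N_def)
  qed
  then show "\<exists>R. competitive d g n R (1536 * real d)"
    unfolding competitive_def by blast
qed simp

end
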